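(* Let $\ell\ge6$ be even and not divisible by four. Then $C(W,\ell)\le1$ for every tournamenton $W$, and equality holds if and only if $W$ is equal to $1/2$ almost everywhere. In particular, $c(\ell)=1$.
   Context: A tournamenton is a measurable $W:[0,1]^2\to[0,1]$ with $W(x,y)+W(y,x)=1$ for all $x,y$. $C(W,\ell)=2^{\ell}\int_{[0,1]^\ell}W(x_1,x_2)W(x_2,x_3)\cdots W(x_{\ell-1},x_\ell)W(x_\ell,x_1)\,dx_1\cdots dx_\ell$. For $n\ge\ell$, $C(n,\ell)$ is the maximum number of directed cycles of length $\ell$ in an $n$-vertex tournament, $R(n,\ell)=\frac{(\ell-1)!}{2^\ell}\binom n\ell$, and $c(\ell)=\lim_{n\to\infty}C(n,\ell)/R(n,\ell)$; equivalently $c(\ell)$ is the maximum of $C(W,\ell)$ over all tournamentons $W$. *)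

theory Defs
  imports "HOL-Analysis.Analysis"
begin

text \<open>The values of \<open>W\<close> outside the unit square are irrelevant: a tournamenton is encoded by
  any total function whose restriction to the unit square is one. Measurability is Lebesgue
  measurability (so Borel functions are included).\<close>

definition tournamenton :: "(real \<Rightarrow> real \<Rightarrow> real) \<Rightarrow> bool" where
  "tournamenton W \<longleftrightarrow>
     (\<lambda>(x, y). W x y) \<in> borel_measurable (lebesgue_on ({0..1} \<times> {0..1})) \<and>
     (\<forall>x\<in>{0..1}. \<forall>y\<in>{0..1}. 0 \<le> W x y \<and> W x y \<le> 1 \<and> W x y + W y x = 1)"

text \<open>Lebesgue measure on the cube \<open>[0,1]\<^sup>l\<close>, with coordinates \<open>0, \<dots>, l - 1\<close>. The completion is
  needed because the integrand of the cycle density is only Lebesgue measurable in general.\<close>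

definition cube_measure :: "nat \<Rightarrow> (nat \<Rightarrow> real) measure" where
  "cube_measure l = completion (Pi\<^sub>M {..<l} (\<lambda>_. restrict_space lborel {0..1}))"

definition cycle_density :: "(real \<Rightarrow> real \<Rightarrow> real) \<Rightarrow> nat \<Rightarrow> real" where
  "cycle_density W l =
     2 ^ l * (LINT x|cube_measure l. (\<Prod>i<l. W (x i) (x (Suc i mod l))))"

definition tournament :: "'a set \<Rightarrow> ('a \<times> 'a) set \<Rightarrow> bool" where
  "tournament V E \<longleftrightarrow>
     E \<subseteq> V \<times> V \<and> irrefl E \<and>
     (\<forall>u\<in>V. \<forall>v\<in>V. u \<noteq> v \<longrightarrow> ((u, v) \<in> E \<longleftrightarrow> (v, u) \<notin> E))"

text \<open>A directed cycle is identified with its set of arcs, so that the \<open>l\<close> rotations of the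
  vertex list \<open>vs\<close> give the same cycle.\<close>

definition dicycles :: "('a \<times> 'a) set \<Rightarrow> nat \<Rightarrow> ('a \<times> 'a) set set" where
  "dicycles E l =
     {C. C \<subseteq> E \<and>
         (\<exists>vs. length vs = l \<and> distinct vs \<and> C = {(vs ! i, vs ! (Suc i mod l)) | i. i < l})}"

definition max_cycles :: "nat \<Rightarrow> nat \<Rightarrow> nat" where
  "max_cycles n l = Max {card (dicycles E l) | E. tournament {..<n} E}"

text \<open>The expected number of directed cycles of length \<open>l\<close> in a uniformly random tournament
  on \<open>n\<close> vertices.\<close>

definition random_cycles :: "nat \<Rightarrow> nat \<Rightarrow> real" where
  "random_cycles n l = fact (l - 1) / 2 ^ l * real (n choose l)"

definition cycle_ratio :: "nat \<Rightarrow> nat \<Rightarrow> real" where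
  "cycle_ratio l n = real (max_cycles n l) / random_cycles n l"

definition cycle_limit :: "nat \<Rightarrow> real" where
  "cycle_limit l = lim (cycle_ratio l)"

end

theory Submission
  imports Defs "HOL-Probability.Probability" "Jordan_Normal_Form.Schur_Decomposition"
begin

text \<open>
  Put \<open>K = 2 W\<close>, so that \<open>K = 1 + A\<close> with \<open>A\<close> antisymmetric, and \<open>C(W, l)\<close> is the trace of \<open>K ^ l\<close>.
  For an \<open>n \<times> n\<close> matrix \<open>a\<close> with \<open>a i j + a j i = 2\<close>, the eigenvalues of \<open>a / n\<close> have nonnegative real
  part and sum to 1, hence nonreal ones, which come in conjugate pairs, have real part at most
  \<open>1/2\<close>; their imaginary parts are bounded because of \<open>\<bar>a i j - 1\<bar> \<le> 1\<close>. On the resulting region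
  \<open>Re (z ^ l) \<le> Re z\<close> whenever \<open>l \<ge> 6\<close> and \<open>l mod 4 = 2\<close>, so the trace of \<open>(a / n) ^ l\<close> is at most 1.
  Evaluating \<open>K\<close> at \<open>n\<close> random points and letting \<open>n\<close> tend to infinity transfers this to kernels,
  and applying it to the adjacency matrix of a tournament bounds \<open>c(l)\<close> from above; the lower
  bound is the average over all tournaments.

  For the equality case, the matrix inequality has some slack: it still holds when \<open>\<bar>a i j - 1\<bar>\<close> is
  slightly larger than 1. A kernel with \<open>C(W, l) = 1\<close> is therefore an interior maximum, and the first
  variation shows that \<open>S = K ^ (l - 1)\<close> is symmetric. Hence \<open>\<integral> S = tr (S K) = 1\<close>, while the inequality
  for the length \<open>2 (l - 1)\<close> gives \<open>\<integral> S\<^sup>2 = tr (S\<^sup>2) \<le> 1\<close>; so \<open>S = 1\<close> almost everywhere. It follows that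
  \<open>A\<close> annihilates constants and is nilpotent, and an antisymmetric nilpotent operator vanishes.
\<close>

text \<open>The residue of \<open>l\<close> matters near the imaginary axis: for
  \<open>z = iy\<close> with \<open>y\<close> real and nonzero, \<open>z ^ l\<close> is negative
  when \<open>l mod 4 = 2\<close> but positive when 4 divides \<open>l\<close>. The bound on
  \<open>Re (z ^ l)\<close> is linear in \<open>Re z\<close> so that summing it over the
  eigenvalues, whose sum is known, gives the trace bound. Sampling takes the place of spectral
  theory for the integral operator of \<open>K\<close>, which need not be normal. Its price is the
  closed walks that repeat a sampled point; they form a vanishing fraction. Equality cannot be read
  off the matrix inequality, because strictness is lost as \<open>n\<close> grows; hence the
  variational argument. The length \<open>2 (l - 1)\<close> is admissible since \<open>l - 1\<close>
  is odd. That \<open>A\<close> annihilates constants comes from \<open>S\<close>, which acts as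
  averaging, commuting with \<open>K\<close>. Then, with \<open>J\<close> the constant kernel 1,
  \<open>A J = J A = 0\<close> and \<open>J J = J\<close>, so
  \<open>(J + A) ^ (l - 1) = J + A ^ (l - 1)\<close>; the left side being \<open>J\<close>, the
  power of \<open>A\<close> vanishes.\<close>

section \<open>Powers of complex numbers in a strip\<close>

text \<open>This is \<open>Re_power_le\<close> for \<open>l = 6\<close>, with
  \<open>x = Re z\<close> and \<open>Y = (Im z)^2\<close>. For small \<open>x\<close> the two
  positive terms are bounded by multiples of \<open>x\<close>. For larger \<open>x\<close> a
  quadratic in \<open>Y\<close> is almost increasing, so \<open>Y\<close> may be replaced by its
  largest value.\<close>

lemma sextic_le:
  fixes x Y :: real
  assumes x: "0 \<le> x" "x \<le> 1/2" and Y: "0 \<le> Y" "Y \<le> 511/1000"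
  shows "x^6 - 15*x^4*Y + 15*x^2*Y^2 - Y^3 \<le> x"
proof (cases "x \<le> 255/1000")
  case True
  have "Y^2 \<le> (511/1000)^2" using Y by (intro power_mono) auto
  then have "15*x^2*Y^2 \<le> 15*x^2*(511/1000)^2" by (intro mult_left_mono) auto
  also have "\<dots> = (15*(511/1000)^2*x) * x" by (simp add: power2_eq_square)
  also have "\<dots> \<le> (15*(511/1000)^2*(255/1000)) * x" using x True by (intro mult_right_mono) auto
  finally have 1: "15*x^2*Y^2 \<le> (15*(511/1000)^2*(255/1000)) * x" .
  have "x^6 = x^5 * x" by (simp add: power_numeral_reduce)
  also have "\<dots> \<le> (255/1000)^5 * x" using x True by (intro mult_right_mono power_mono) auto
  finally have 2: "x^6 \<le> (255/1000)^5 * x" .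
  have "0 \<le> 15*x^4*Y" "0 \<le> Y^3" using x Y by auto
  \<comment> \<open>The left side is about 0.9999: \<open>255/1000\<close> is nearly the largest cut
    that this estimate allows.\<close>
  moreover have "15*(511/1000)^2*(255/1000) + (255/1000)^5 \<le> (1::real)" by (simp add: power_numeral_reduce)
  then have "15*(511/1000)^2*(255/1000) * x + (255/1000)^5 * x \<le> x"
    using x mult_right_mono[of _ 1 x] by (simp only: distrib_right[symmetric] mult_1_left)
  ultimately show ?thesis using 1 2 by linarith
next
  case False
  let ?c = "511/1000 :: real"
  have x2: "x^2 \<ge> (255/1000)^2" using False by (intro power_mono) auto
  define d where "d = ?c - Y"
  have d: "d \<ge> 0" "Y = ?c - d" using Y by (auto simp: d_def)
  \<comment> \<open>The parabola \<open>Y * (15*x^2 - Y)\<close> has its vertex at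
    \<open>15*x^2/2\<close>, which for \<open>x\<close> near \<open>255/1000\<close> lies slightly
    below \<open>?c\<close>. Replacing \<open>Y\<close> by \<open>?c\<close> therefore costs a
    little, at most \<open>1/1000\<close>.\<close>
  have "d * (15*x^2 - 2*?c) \<ge> d * (15*(255/1000)^2 - 2*?c)" using d x2 by (intro mult_left_mono) auto
  moreover have "d * (15*(255/1000)^2 - 2*?c) + d^2 \<ge> -1/1000"
  proof -
    \<comment> \<open>\<open>1/42\<close> approximates the minimiser of the quadratic in
      \<open>d\<close>.\<close>
    have "0 \<le> (d - 1/42)^2" by simp
    then show ?thesis using d by (simp add: power2_eq_square algebra_simps)
  qed
  moreover have "c * (15*x^2 - c) - (c - d) * (15*x^2 - (c - d)) = d * (15*x^2 - 2*c) + d^2" for c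
    by (simp add: power2_eq_square algebra_simps)
  from this[of ?c] have "?c * (15*x^2 - ?c) - Y * (15*x^2 - Y) = d * (15*x^2 - 2*?c) + d^2"
    unfolding d(2) .
  ultimately have *: "Y * (15*x^2 - Y) \<le> ?c * (15*x^2 - ?c) + 1/1000"
    by linarith
  have x6: "x^6 \<le> 1/64" using power_mono[of x "1/2" 6] x by (simp add: power_numeral_reduce)
  define B where "B = ?c * (15*x^2 - ?c) + 1/1000 - 15*x^4"
  \<comment> \<open>By convexity \<open>x^2\<close> lies below its chord over the interval from
    \<open>255/1000\<close> to \<open>1/2\<close>.\<close>
  have xx: "x^2 \<le> 755/1000 * x - 255/2000"
  proof -
    have "0 \<le> (1/2 - x) * (x - 255/1000)" using x False by simp
    also have "(b - x) * (x - a) = (a + b) * x - x^2 - a * b" for a b :: real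
      by (simp add: power2_eq_square algebra_simps)
    finally show ?thesis by simp
  qed
  \<comment> \<open>The tangent of the square of \<open>x^2\<close> at \<open>x = 45/100\<close>.
    Together with the chord it leaves an inequality that is linear in \<open>x\<close>.\<close>
  have x4: "x^4 \<ge> 405/1000 * x^2 - (2025/10000)^2"
  proof -
    have "0 \<le> (x^2 - 2025/10000)^2" by simp
    then show ?thesis by (simp add: power2_eq_square power_numeral_reduce algebra_simps)
  qed
  have "x^6 - 15*x^4*Y + 15*x^2*Y^2 - Y^3 = x^6 + Y * (Y * (15*x^2 - Y) - 15*x^4)"
    by (simp add: power_numeral_reduce algebra_simps)
  also have "\<dots> \<le> x^6 + Y * B" using * Y by (intro add_left_mono mult_left_mono) (auto simp: B_def)
  also have "Y * B \<le> max 0 (?c * B)"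
  proof (cases "B \<ge> 0")
    case True
    then have "Y * B \<le> ?c * B" using Y by (intro mult_right_mono) auto
    then show ?thesis by linarith
  next
    case False
    then have "Y * B \<le> 0" using Y by (intro mult_nonneg_nonpos) auto
    then show ?thesis by linarith
  qed
  also have "x^6 + max 0 (?c * B) \<le> x"
  proof -
    have "?c * B = 783363/200000 * x^2 - 132921831/1000000000 - 7665/1000 * x^4"
      by (simp add: B_def algebra_simps)
    moreover have "x^4 \<ge> 405/1000 * x^2 - 4100625/100000000" using x4 by (simp add: power2_eq_square[of "_/_"])
    ultimately have "x^6 + ?c * B \<le> x" using x6 xx False by linarith
    moreover have "x^6 \<le> x" using x6 False by simp
    ultimately show ?thesis by (simp add: max_def)
  qed
  finally show ?thesis by simp
qed

lemma sin_ge_half: assumes "0 \<le> t" "t \<le> pi/3" shows "sin t \<ge> t / 2"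
proof (cases "t = 0")
  case False
  with assms have t: "0 < t" by simp
  obtain z where z: "0 < z" "z < t" "sin t - sin 0 = (t - 0) * cos z"
    using MVT2[OF t, of sin cos] by (auto intro: DERIV_sin)
  have "cos (pi/3) \<le> cos z" using z assms by (intro cos_monotone_0_pi_le) auto
  then have "t * (1/2) \<le> t * cos z" using t by (intro mult_left_mono) (auto simp: cos_60)
  with z show ?thesis by simp
qed auto

text \<open>For \<open>l \<ge> 10\<close> the modulus alone suffices unless \<open>Re z\<close> is
  close to 0. There the angle \<open>\<phi>\<close> to the imaginary axis decides:
  \<open>l mod 4 = 2\<close> turns the cosine of \<open>l * \<theta>\<close> into minus that of
  \<open>l * \<phi>\<close>, so either \<open>z^l\<close> has nonpositive real part or
  \<open>\<phi>\<close> is so large that \<open>r * sin \<phi>\<close> exceeds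
  \<open>r^l\<close>.\<close>

lemma Re_power_le:
  fixes z :: complex
  assumes x: "0 \<le> Re z" "Re z \<le> 1/2" and y: "(Im z)^2 \<le> 511/1000"
    and l: "l \<ge> 6" "l mod 4 = 2"
  shows "Re (z^l) \<le> Re z"
proof (cases "l = 6")
  case True
  have "Re (z^6) = (Re z)^6 - 15*(Re z)^4*(Im z)^2 + 15*(Re z)^2*((Im z)^2)^2 - ((Im z)^2)^3"
    by (simp add: power_numeral_reduce algebra_simps)
  with sextic_le[OF x _ y] True show ?thesis by simp
next
  case False
  with l have l10: "l \<ge> 10" by presburger
  define r where "r = cmod z"
  have r0: "r \<ge> 0" by (simp add: r_def)
  have r2: "r^2 \<le> (Re z)^2 + 511/1000" using y by (simp add: r_def cmod_power2)
  have sq: "(Re z)^2 \<le> (1/2)^2" using x by (intro power_mono) auto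
  have r1: "r \<le> 1" 
  proof -
    have "r^2 \<le> 1^2" using r2 sq by (simp add: power2_eq_square)
    then show ?thesis by (rule power2_le_imp_le) simp
  qed
  have rl: "Re (z^l) \<le> r^l" using complex_Re_le_cmod[of "z^l"] by (simp add: r_def norm_power)
  \<comment> \<open>While \<open>Re z\<close> stays between \<open>a\<close> and \<open>b\<close>,
    it is enough that the tenth power of the largest modulus is at most \<open>a\<close>. The cuts
    4/100, 1/10, 3/10, 1/2 below are spaced so that this holds on each piece.\<close>
  have step: "Re (z^l) \<le> Re z" if "a \<le> Re z" "Re z \<le> b" "(b^2 + 511/1000)^5 \<le> a" for a b
  proof -
    have "r^l \<le> r^10" using l10 r0 r1 by (intro power_decreasing) auto
    also have "\<dots> = (r^2)^5" by (simp flip: power_mult)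
    also have "\<dots> \<le> ((Re z)^2 + 511/1000)^5" using r2 by (intro power_mono) auto
    also have "\<dots> \<le> (b^2 + 511/1000)^5" using that x by (intro power_mono add_right_mono) auto
    finally show ?thesis using that rl by linarith
  qed
  consider "Re z \<le> 4/100" | "4/100 \<le> Re z" "Re z \<le> 1/10" | "1/10 \<le> Re z" "Re z \<le> 3/10" | "3/10 \<le> Re z"
    by linarith
  then show ?thesis
  proof cases
    case 2 then show ?thesis by (rule step) (simp add: power_numeral_reduce)
  next
    case 3 then show ?thesis by (rule step) (simp add: power_numeral_reduce)
  next
    case 4 then show ?thesis using x(2) by (rule step) (simp add: power_numeral_reduce)
  next
    case 1
    have "(Re z)^2 \<le> (4/100)^2" using x 1 by (intro power_mono) auto
    then have r2': "r^2 \<le> 513/1000" using r2 by (simp add: power2_eq_square)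
    have r9: "r^9 \<le> 5/100"
    proof -
      have "(r^9)^2 = (r^2)^9" by (simp flip: power_mult)
      also have "\<dots> \<le> (513/1000)^9" using r2' by (intro power_mono) auto
      also have "\<dots> \<le> (5/100)^2" by (simp add: power_numeral_reduce)
      finally show ?thesis by (rule power2_le_imp_le) simp
    qed
    \<comment> \<open>At \<open>l = 10\<close> this is the bound \<open>5/100\<close> for
      \<open>r^9\<close>. Raising \<open>l\<close> by one multiplies the left side by
      \<open>r * (l + 1) / l\<close>, which is below 1 because \<open>r \<le> 8/10\<close>.\<close>
    have lr: "real l * r^(l-1) \<le> 5/10"
    proof -
      have "real (10 + n) * r^(9+n) \<le> 5/10" for n
      proof (induction n)
        case 0 then show ?case using r9 by simp
      next
        case (Suc n)
        have r3: "r \<le> 8/10" 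
        proof -
          have "r^2 \<le> (8/10)^2" using r2' by (simp add: power2_eq_square)
          then show ?thesis by (rule power2_le_imp_le) simp
        qed
        have "real (10 + Suc n) * r \<le> real (10 + Suc n) * (8/10)" using r3 by (intro mult_left_mono) auto
        also have "\<dots> \<le> real (10 + n)" by simp
        finally have "(real (10 + Suc n) * r) * r^(9+n) \<le> real (10 + n) * r^(9+n)"
          using r0 by (intro mult_right_mono) auto
        moreover have "(real (10 + Suc n) * r) * r^(9+n) = real (10 + Suc n) * r^(9 + Suc n)"
          unfolding add_Suc_right power_Suc by (simp only: mult_ac)
        ultimately show ?case using Suc by linarith
      qed
      from this[of "l - 10"] show ?thesis using l10 by (simp add: algebra_simps)
    qed
    show ?thesis
    proof (cases "z = 0")
      case True then show ?thesis using l by (simp add: power_0_left)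
    next
      case False
      then have rpos: "r > 0" by (simp add: r_def)
      define \<theta> where "\<theta> = \<bar>Arg z\<bar>"
      define \<phi> where "\<phi> = pi/2 - \<theta>"
      have z: "z = rcis r (Arg z)" by (simp add: r_def rcis_cmod_Arg)
      have "Re z = r * cos (Arg z)" using arg_cong[OF z, of Re] by simp
      then have Rez: "Re z = r * cos \<theta>" by (simp add: \<theta>_def)
      have "cos \<theta> \<ge> 0" using Rez x(1) rpos by (simp add: zero_le_mult_iff)
      have \<theta>: "0 \<le> \<theta>" "\<theta> \<le> pi" using Arg_bounded[of z] by (auto simp: \<theta>_def)
      have \<theta>2: "\<theta> \<le> pi/2"
      proof (rule ccontr)
        assume "\<not> \<theta> \<le> pi/2"
        then have "cos \<theta> < cos (pi/2)" using \<theta> by (intro cos_monotone_0_pi) auto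
        with \<open>cos \<theta> \<ge> 0\<close> show False by simp
      qed
      have \<phi>: "0 \<le> \<phi>" "\<phi> \<le> pi/2" using \<theta> \<theta>2 by (auto simp: \<phi>_def)
      have Rez': "Re z = r * sin \<phi>" using Rez by (simp add: \<phi>_def sin_cos_eq)
      have "Re (z^l) = r^l * cos (real l * Arg z)"
        by (subst z) (simp add: DeMoivre2)
      also have "cos (real l * Arg z) = cos (real l * \<theta>)"
        by (cases "Arg z \<ge> 0") (auto simp: \<theta>_def)
      also have "cos (real l * \<theta>) = - cos (real l * \<phi>)"
      proof -
        obtain k where k: "l = 4*k + 2" using l(2) by (metis mult_div_mod_eq)
        have "real l * \<theta> = pi - real l * \<phi> + real (2*k) * pi"
          unfolding \<phi>_def k by (simp add: algebra_simps)
        then have "cos (real l * \<theta>) = cos (pi - real l * \<phi>)"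
          by (simp only: cos_add[of "pi - real l * \<phi>"] cos_npi sin_npi) simp
        then show ?thesis by simp
      qed
      finally have Rel: "Re (z^l) = - (r^l * cos (real l * \<phi>))" by simp
      show ?thesis
      proof (cases "real l * \<phi> \<le> pi/2")
        case True
        then have "cos (real l * \<phi>) \<ge> 0" using \<phi> order.trans[of "- (pi/2)" 0 "real l * \<phi>"]
          by (intro cos_ge_zero) auto
        then show ?thesis using Rel x r0 by (smt (verit) mult_nonneg_nonneg zero_le_power)
      next
        case False
        \<comment> \<open>The angle up to which \<open>cos (l * \<phi>)\<close> is certainly
          nonnegative. Beyond it \<open>sin \<phi>\<close> is at least
          \<open>t / 2 = pi / (4 * l)\<close>, more than the bound \<open>(5/10) / l\<close> for
          \<open>r^(l-1)\<close>.\<close>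
        define t where "t = pi / (2 * real l)"
        have t: "0 \<le> t" "t \<le> pi/3" using l10 by (auto simp: t_def field_simps)
        have "t \<le> \<phi>" using False l10 by (simp add: t_def field_simps)
        then have "sin t \<le> sin \<phi>" using \<phi> t pi_gt_zero by (intro sin_monotone_2pi_le) auto
        with sin_ge_half[OF t] have "sin \<phi> \<ge> pi / (4 * real l)" by (simp add: t_def)
        moreover have "pi / (4 * real l) \<ge> (5/10) / real l" using pi_ge_two l10 by (simp add: field_simps)
        ultimately have sp: "sin \<phi> \<ge> (5/10) / real l" by linarith
        have "r^(l-1) \<le> (5/10) / real l" using lr l10 by (simp add: field_simps)
        then have "r^(l-1) \<le> sin \<phi>" using sp by linarith
        then have "r * r^(l-1) \<le> r * sin \<phi>" using r0 by (intro mult_left_mono) auto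
        moreover have "r * r^(l-1) = r^l" using l10 by (cases l) auto
        ultimately show ?thesis using Rez' rl by simp
      qed
    qed
  qed
qed

section \<open>Traces of powers of matrices\<close>

lemma Re_sum_list: "Re (\<Sum>x\<leftarrow>xs. f x) = (\<Sum>x\<leftarrow>xs. Re (f x))"
  by (induction xs) auto

definition mtrace :: "'a::comm_ring_1 mat \<Rightarrow> 'a" where
  "mtrace A = (\<Sum>i<dim_row A. A $$ (i,i))"

lemma mtrace_mult_comm:
  assumes "A \<in> carrier_mat n m" "B \<in> carrier_mat m n"
  shows "mtrace (A * B) = mtrace (B * A)"
proof -
  have "mtrace (A * B) = (\<Sum>i<n. \<Sum>j<m. A $$ (i,j) * B $$ (j,i))"
    using assms by (simp add: mtrace_def scalar_prod_def lessThan_atLeast0)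
  also have "\<dots> = (\<Sum>j<m. \<Sum>i<n. B $$ (j,i) * A $$ (i,j))"
    by (subst sum.swap) (simp add: mult.commute)
  also have "\<dots> = mtrace (B * A)"
    using assms by (simp add: mtrace_def scalar_prod_def lessThan_atLeast0)
  finally show ?thesis .
qed

lemma mtrace_similar:
  assumes A: "A \<in> carrier_mat n n" and "similar_mat_wit A B P Q"
  shows "mtrace A = mtrace B"
proof -
  note w = similar_mat_witD2[OF assms]
  have "mtrace A = mtrace (P * (B * Q))" using w by (simp add: assoc_mult_mat[of _ n n _ n _ n])
  also have "\<dots> = mtrace (B * Q * P)" using w by (intro mtrace_mult_comm) auto
  also have "B * Q * P = B" using w by (simp add: assoc_mult_mat[of _ n n _ n _ n])
  finally show ?thesis .
qed

lemma upper_triangular_mult: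
  fixes A B :: "'a::comm_ring_1 mat"
  assumes A: "A \<in> carrier_mat n n" "upper_triangular A" and B: "B \<in> carrier_mat n n" "upper_triangular B"
  shows "upper_triangular (A * B)" and "i < n \<Longrightarrow> (A * B) $$ (i,i) = A $$ (i,i) * B $$ (i,i)"
proof -
  have z: "A $$ (i,k) * B $$ (k,j) = 0" if "i < n" "j < n" "k < n" "j \<le> i" "k \<noteq> i \<or> k \<noteq> j" for i j k
  proof (cases "k < i")
    case True then show ?thesis using A that by (auto simp: upper_triangular_def)
  next
    case False then show ?thesis using B that by (auto simp: upper_triangular_def)
  qed
  show "upper_triangular (A * B)"
  proof (rule upper_triangularI)
    fix i j assume "j < i" "i < dim_row (A * B)"
    then show "(A * B) $$ (i,j) = 0"
      using A B by (auto simp: scalar_prod_def intro!: sum.neutral z)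
  qed
  assume i: "i < n"
  have "(A * B) $$ (i,i) = (\<Sum>k=0..<n. A $$ (i,k) * B $$ (k,i))"
    using A B i by (simp add: scalar_prod_def)
  also have "\<dots> = (\<Sum>k\<in>{i}. A $$ (i,k) * B $$ (k,i))"
    using i z by (intro sum.mono_neutral_right) auto
  finally show "(A * B) $$ (i,i) = A $$ (i,i) * B $$ (i,i)" by simp
qed

lemma upper_triangular_pow:
  fixes A :: "'a::comm_ring_1 mat"
  assumes A: "A \<in> carrier_mat n n" "upper_triangular A"
  shows "upper_triangular (A ^\<^sub>m k) \<and> (\<forall>i<n. (A ^\<^sub>m k) $$ (i,i) = (A $$ (i,i)) ^ k)"
proof (induction k)
  case 0
  then show ?case using A by auto
next
  case (Suc k)
  then show ?case
    using upper_triangular_mult[of "A ^\<^sub>m k" n A] A by (auto simp: mult.commute)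
qed

text \<open>Since the matrix need not be diagonalisable, a Schur triangularisation is used: powers
  of a triangular matrix have the powers on the diagonal. The list \<open>es\<close> keeps
  multiplicities.\<close>

lemma mtrace_pow_eigenvalues:
  fixes A :: "complex mat"
  assumes A: "A \<in> carrier_mat n n" 
  shows "\<exists>es. (\<forall>e. e \<in> set es \<longleftrightarrow> eigenvalue A e) \<and> (\<forall>k. mtrace (A ^\<^sub>m k) = (\<Sum>e\<leftarrow>es. e ^ k))"
proof -
  obtain es where es: "char_poly A = (\<Prod>e\<leftarrow>es. [:- e, 1:])"
    using char_poly_factorized[OF A] by blast
  obtain B P Q where "schur_decomposition A es = (B, P, Q)" by (metis prod_cases3)
  from schur_decomposition[OF A es this]
  have w: "similar_mat_wit A B P Q" and ut: "upper_triangular B" and dg: "diag_mat B = es" by auto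
  have B: "B \<in> carrier_mat n n" using similar_mat_witD2[OF A w] by auto
  have "mtrace (A ^\<^sub>m k) = (\<Sum>e\<leftarrow>es. e ^ k)" for k
  proof -
    have "mtrace (A ^\<^sub>m k) = mtrace (B ^\<^sub>m k)"
      using A by (intro mtrace_similar[of _ n _ P Q] similar_mat_wit_pow w) auto
    also have "\<dots> = (\<Sum>i<n. (B $$ (i,i)) ^ k)"
      using upper_triangular_pow[OF B ut, of k] B by (simp add: mtrace_def)
    also have "\<dots> = (\<Sum>e\<leftarrow>es. e ^ k)"
      using B by (simp add: dg[symmetric] diag_mat_def sum_list_sum_nth atLeast0LessThan comp_def)
    finally show ?thesis .
  qed
  moreover have "e \<in> set es \<longleftrightarrow> eigenvalue A e" for e
    unfolding eigenvalue_root_char_poly[OF A] es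
    by (induction es) auto
  ultimately show ?thesis by blast
qed

section \<open>Eigenvalues of a real matrix whose symmetric part is the all-ones matrix\<close>

lemma eigenvector_sum:
  fixes A :: "'a::comm_ring_1 mat"
  assumes A: "A \<in> carrier_mat n n" and "eigenvector A v e" and i: "i < n"
  shows "(\<Sum>j<n. A $$ (i,j) * vec_index v j) = e * vec_index v i"
proof -
  have v: "v \<in> carrier_vec n" "A *\<^sub>v v = e \<cdot>\<^sub>v v" using assms by (auto simp: eigenvector_def)
  have "vec_index (A *\<^sub>v v) i = (\<Sum>j<n. A $$ (i,j) * vec_index v j)"
    using A v(1) i by (simp add: scalar_prod_def lessThan_atLeast0)
  then show ?thesis using v i by simp
qed

text \<open>Both bounds come from the quadratic form \<open>Q\<close> at the eigenvector. Its real
  part sees only the symmetric part of \<open>a\<close>, the all-ones matrix, which is positive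
  semidefinite. Its imaginary part sees only the antisymmetric part \<open>a - 1\<close>, to which
  Cauchy-Schwarz applies.\<close>

lemma eigenvalue_bounds:
  fixes a :: "nat \<Rightarrow> nat \<Rightarrow> real" and v :: "nat \<Rightarrow> complex"
  assumes sym: "\<And>i j. i < n \<Longrightarrow> j < n \<Longrightarrow> a i j + a j i = 2"
    and bd: "\<And>i j. i < n \<Longrightarrow> j < n \<Longrightarrow> \<bar>a i j - 1\<bar> \<le> s"
    and ev: "\<And>i. i < n \<Longrightarrow> (\<Sum>j<n. of_real (a i j) * v j) = e * v i"
    and nz: "\<exists>i<n. v i \<noteq> 0"
  shows "0 \<le> Re e" and "2 * (Im e)^2 \<le> (real n * s)^2"
proof -
  define p q where "p i = Re (v i)" and "q i = Im (v i)" for i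
  define N where "N = (\<Sum>i<n. (p i)^2 + (q i)^2)"
  obtain i0 where "i0 < n" "v i0 \<noteq> 0" using nz by blast
  then have N: "N > 0" unfolding N_def
    by (intro sum_pos2[of _ i0]) (auto simp: p_def q_def complex_eq_iff sum_power2_gt_zero_iff)
  define Q where "Q = (\<Sum>i<n. \<Sum>j<n. of_real (a i j) * (cnj (v i) * v j))"
  have "Q = (\<Sum>i<n. cnj (v i) * (\<Sum>j<n. of_real (a i j) * v j))"
    by (simp add: Q_def sum_distrib_left mult_ac)
  also have "\<dots> = (\<Sum>i<n. e * of_real ((p i)^2 + (q i)^2))"
  proof (intro sum.cong refl)
    fix i assume "i \<in> {..<n}"
    then have "cnj (v i) * (\<Sum>j<n. of_real (a i j) * v j) = e * (v i * cnj (v i))" using ev by simp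
    then show "cnj (v i) * (\<Sum>j<n. of_real (a i j) * v j) = e * of_real ((p i)^2 + (q i)^2)"
      by (simp add: complex_mult_cnj p_def q_def)
  qed
  also have "\<dots> = e * of_real N" by (simp add: N_def flip: sum_distrib_left)
  finally have Q: "Q = e * of_real N" .
  define F where "F i j = p i * p j + q i * q j" for i j
  define G where "G i j = p i * q j - q i * p j" for i j
  have "Re e * N = (\<Sum>i<n. \<Sum>j<n. a i j * F i j)"
    using arg_cong[OF Q, of Re] by (simp add: Q_def F_def p_def q_def algebra_simps)
  moreover have "(\<Sum>i<n. \<Sum>j<n. a i j * F i j) = (\<Sum>i<n. \<Sum>j<n. a j i * F i j)"
    by (subst sum.swap) (simp add: F_def algebra_simps)
  ultimately have "2 * (Re e * N) = (\<Sum>i<n. \<Sum>j<n. (a i j + a j i) * F i j)"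
    by (simp add: algebra_simps sum.distrib)
  also have "\<dots> = 2 * (\<Sum>i<n. \<Sum>j<n. F i j)" using sym by (simp add: sum_distrib_left)
  also have "(\<Sum>i<n. \<Sum>j<n. F i j) = (\<Sum>i<n. p i)^2 + (\<Sum>i<n. q i)^2"
    by (simp add: F_def sum.distrib power2_eq_square sum_product)
  finally have "Re e * N = (\<Sum>i<n. p i)^2 + (\<Sum>i<n. q i)^2" by simp
  then have "Re e * N \<ge> 0" by simp
  with N show "0 \<le> Re e" by (simp add: zero_le_mult_iff)

  \<comment> \<open>\<open>G\<close> is antisymmetric; this is what allows \<open>a\<close> to be
    replaced by \<open>a - 1\<close>.\<close>
  have G0: "(\<Sum>i<n. \<Sum>j<n. G i j) = 0"
    unfolding G_def by (simp add: sum_subtractf) (subst sum.swap, simp add: mult.commute)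
  have "Im e * N = (\<Sum>i<n. \<Sum>j<n. a i j * G i j)"
    using arg_cong[OF Q, of Im] by (simp add: Q_def G_def p_def q_def algebra_simps)
  also have "\<dots> = (\<Sum>i<n. \<Sum>j<n. (a i j - 1) * G i j)"
    using G0 by (simp add: algebra_simps sum_subtractf)
  also have "\<dots> = (\<Sum>z\<in>{..<n}\<times>{..<n}. (a (fst z) (snd z) - 1) * G (fst z) (snd z))"
    by (simp add: sum.cartesian_product case_prod_beta)
  finally have "(Im e * N)^2 \<le> (\<Sum>z\<in>{..<n}\<times>{..<n}. (a (fst z) (snd z) - 1)^2) * (\<Sum>z\<in>{..<n}\<times>{..<n}. (G (fst z) (snd z))^2)"
    by (simp add: Cauchy_Schwarz_ineq_sum)
  also have "(\<Sum>z\<in>{..<n}\<times>{..<n}. (a (fst z) (snd z) - 1)^2) \<le> (\<Sum>z\<in>{..<n}\<times>{..<n}. s^2)"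
  proof (intro sum_mono)
    fix z assume "z \<in> {..<n} \<times> {..<n}"
    then have "\<bar>a (fst z) (snd z) - 1\<bar> \<le> \<bar>s\<bar>" using bd[of "fst z" "snd z"] by force
    then show "(a (fst z) (snd z) - 1)^2 \<le> s^2" by (simp only: abs_le_square_iff)
  qed
  also have "(\<Sum>z\<in>{..<n}\<times>{..<n}. s^2) = (real n * s)^2"
    by (simp add: power2_eq_square)
  \<comment> \<open>By Lagrange's identity the sum is at most \<open>2 * (P * R)\<close>, and
    \<open>P + R = N\<close>. The resulting \<open>1/2\<close> is the origin of the factor 2 in the
    bound for \<open>Im e\<close>; without it the strip would be too wide for
    \<open>Re_power_le\<close>.\<close>
  also have "(\<Sum>z\<in>{..<n}\<times>{..<n}. (G (fst z) (snd z))^2) \<le> N^2 / 2"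
  proof -
    define P where "P = (\<Sum>i<n. (p i)^2)" define R where "R = (\<Sum>i<n. (q i)^2)"
    have "(\<Sum>z\<in>{..<n}\<times>{..<n}. (G (fst z) (snd z))^2) = (\<Sum>i<n. \<Sum>j<n. (G i j)^2)"
      by (simp add: sum.cartesian_product case_prod_beta)
    also have "\<dots> = (\<Sum>i<n. \<Sum>j<n. (p i)^2 * (q j)^2 + (q i)^2 * (p j)^2 - 2 * ((p i * q i) * (p j * q j)))"
      by (simp add: G_def power2_eq_square algebra_simps)
    also have "\<dots> = P * R + R * P - 2 * ((\<Sum>i<n. p i * q i) * (\<Sum>i<n. p i * q i))"
      unfolding P_def R_def sum_product sum.distrib sum_subtractf sum_distrib_left[of 2] ..
    also have "\<dots> \<le> 2 * (P * R)" by simp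
    also have "\<dots> \<le> (P + R)^2 / 2" using sum_squares_bound[of P R] by (simp add: power2_eq_square algebra_simps)
    also have "P + R = N" by (simp add: P_def R_def N_def sum.distrib)
    finally show ?thesis .
  qed
  finally have "(Im e)^2 * N^2 \<le> (real n * s)^2 / 2 * N^2"
    by (simp add: power_mult_distrib mult_left_mono sum_nonneg mult_right_mono)
  then have "(Im e)^2 \<le> (real n * s)^2 / 2" using N by (simp add: mult_le_cancel_right)
  then show "2 * (Im e)^2 \<le> (real n * s)^2" by simp
qed

definition rmat :: "nat \<Rightarrow> (nat \<Rightarrow> nat \<Rightarrow> real) \<Rightarrow> complex mat" where
  "rmat n a = mat n n (\<lambda>(i,j). complex_of_real (a i j))"

lemma rmat_carrier [simp]: "rmat n a \<in> carrier_mat n n" by (simp add: rmat_def)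

text \<open>Conjugating the eigenvector works because the matrix is real. In
  \<open>mtrace_rmat_pow_le\<close> this makes the real part of a nonreal eigenvalue count twice in
  the trace.\<close>

lemma eigenvalue_cnj:
  assumes "eigenvalue (rmat n a) e"
  shows "eigenvalue (rmat n a) (cnj e)"
proof -
  obtain v where v: "eigenvector (rmat n a) v e" using assms by (auto simp: eigenvalue_def)
  then have vc: "v \<in> carrier_vec n" and v0: "v \<noteq> 0\<^sub>v n" by (auto simp: eigenvector_def rmat_def)
  have "eigenvector (rmat n a) (map_vec cnj v) (cnj e)"
    unfolding eigenvector_def
  proof (intro conjI)
    show "map_vec cnj v \<in> carrier_vec (dim_row (rmat n a))" using vc by (simp add: rmat_def)
    show "map_vec cnj v \<noteq> 0\<^sub>v (dim_row (rmat n a))"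
    proof
      assume "map_vec cnj v = 0\<^sub>v (dim_row (rmat n a))"
      then have "vec_index (map_vec cnj v) i = 0" if "i < n" for i using that by (simp add: rmat_def)
      then have "v = 0\<^sub>v n" using vc by (intro eq_vecI) auto
      with v0 show False by simp
    qed
    show "rmat n a *\<^sub>v map_vec cnj v = cnj e \<cdot>\<^sub>v map_vec cnj v"
    proof (rule eq_vecI)
      fix i assume "i < dim_vec (cnj e \<cdot>\<^sub>v map_vec cnj v)"
      then have i: "i < n" using vc by simp
      have "(\<Sum>j<n. complex_of_real (a i j) * cnj (vec_index v j)) = cnj e * cnj (vec_index v i)"
        using arg_cong[OF eigenvector_sum[OF rmat_carrier v i], of cnj] i by (simp add: rmat_def)
      then show "vec_index (rmat n a *\<^sub>v map_vec cnj v) i = vec_index (cnj e \<cdot>\<^sub>v map_vec cnj v) i"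
        using i vc by (simp add: rmat_def scalar_prod_def lessThan_atLeast0)
    qed (use vc in \<open>simp add: rmat_def\<close>)
  qed
  then show ?thesis by (auto simp: eigenvalue_def)
qed

text \<open>The bound \<open>101/100\<close> instead of 1 is the slack that the equality case needs; it turns into
  \<open>(Im z)\<^sup>2 \<le> (101/100)\<^sup>2 / 2 < 511/1000\<close> for the normalised eigenvalues.\<close>

lemma mtrace_rmat_pow_le:
  fixes a :: "nat \<Rightarrow> nat \<Rightarrow> real"
  assumes sym: "\<And>i j. i < n \<Longrightarrow> j < n \<Longrightarrow> a i j + a j i = 2"
    and bd: "\<And>i j. i < n \<Longrightarrow> j < n \<Longrightarrow> \<bar>a i j - 1\<bar> \<le> 101/100"
    and l: "l \<ge> 6" "l mod 4 = 2"
  shows "Re (mtrace (rmat n a ^\<^sub>m l)) \<le> real n ^ l"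
proof (cases "n = 0")
  case True then show ?thesis using l by (simp add: mtrace_def rmat_def)
next
  case False
  then have n: "real n > 0" by simp
  let ?A = "rmat n a"
  obtain es where es: "\<And>e. e \<in> set es \<longleftrightarrow> eigenvalue ?A e"
    and tr: "\<And>k. mtrace (?A ^\<^sub>m k) = (\<Sum>e\<leftarrow>es. e ^ k)"
    using mtrace_pow_eigenvalues[OF rmat_carrier] by blast
  have bounds: "0 \<le> Re e" "2 * (Im e)^2 \<le> (real n * (101/100))^2" if e: "e \<in> set es" for e
  proof -
    obtain v where v: "eigenvector ?A v e" using e es[of e] unfolding eigenvalue_def by blast
    then have vc: "v \<in> carrier_vec n" and v0: "v \<noteq> 0\<^sub>v n" by (auto simp: eigenvector_def rmat_def)
    have nz: "\<exists>i<n. vec_index v i \<noteq> 0"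
    proof (rule ccontr)
      assume "\<not> ?thesis"
      then have "v = 0\<^sub>v n" using vc by (intro eq_vecI) auto
      with v0 show False by simp
    qed
    have ev: "(\<Sum>j<n. of_real (a i j) * vec_index v j) = e * vec_index v i" if "i < n" for i
      using eigenvector_sum[OF rmat_carrier v that] that by (simp add: rmat_def)
    show "0 \<le> Re e" "2 * (Im e)^2 \<le> (real n * (101/100))^2"
      using eigenvalue_bounds[of n a "101/100" "vec_index v" e] sym bd ev nz by auto
  qed
  have "mtrace (?A ^\<^sub>m 1) = (\<Sum>i<n. complex_of_real (a i i))"
    by (simp add: mtrace_def rmat_def)
  \<comment> \<open>Taking \<open>i = j\<close> in \<open>sym\<close> shows that the diagonal
    entries are 1.\<close>
  also have "\<dots> = (\<Sum>i<n. 1)" using sym by (intro sum.cong refl) (metis lessThan_iff mult_2 mult_cancel_left1 of_real_1 zero_neq_numeral mult.right_neutral mult_left_cancel)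
  finally have "(\<Sum>e\<leftarrow>es. e) = of_nat n" using tr[of 1] by simp
  then have sumRe: "(\<Sum>e\<leftarrow>es. Re e) = real n"
    using Re_sum_list[of "\<lambda>e. e" es] by simp
  have key: "Re (e ^ l) \<le> real n ^ (l-1) * Re e" if e: "e \<in> set es" for e
  proof (cases "Im e = 0")
    case True
    then have ee: "e = of_real (Re e)" by (simp add: complex_eq_iff)
    have "Re e \<le> (\<Sum>e\<leftarrow>es. Re e)" using e bounds(1) by (intro member_le_sum_list) auto
    then have "Re e \<le> n" using sumRe by simp
    then have "Re e ^ (l-1) * Re e \<le> real n ^ (l-1) * Re e"
      using bounds(1)[OF e] by (intro mult_right_mono power_mono) auto
    moreover have "Re (e ^ l) = Re e ^ (l-1) * Re e"
      using l by (subst ee) (cases l, auto simp flip: of_real_power)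
    ultimately show ?thesis by simp
  next
    case False
    define z where "z = e / of_nat n"
    have ez: "e = of_nat n * z" using n by (simp add: z_def)
    \<comment> \<open>As \<open>cnj e\<close> differs from \<open>e\<close>, it survives the removal
      of one copy of \<open>e\<close>. The other real parts are nonnegative, so
      \<open>2 * Re e \<le> n\<close>.\<close>
    have "cnj e \<in> set es" using e eigenvalue_cnj by (simp add: es)
    moreover have ne: "cnj e \<noteq> e" using False by (simp add: complex_eq_iff)
    ultimately have "cnj e \<in> set (remove1 e es)" by (simp add: in_set_remove1)
    then have "Re (cnj e) \<in> set (map Re (remove1 e es))" by (simp only: set_map imageI)
    then have "Re (cnj e) \<le> (\<Sum>e\<leftarrow>remove1 e es. Re e)"
      using bounds(1) by (intro member_le_sum_list) (auto dest: notin_set_remove1 set_remove1_subset[THEN subsetD])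
    moreover have "(\<Sum>e\<leftarrow>es. Re e) = Re e + (\<Sum>e\<leftarrow>remove1 e es. Re e)"
      using e by (simp add: sum_list_map_remove1)
    ultimately have "2 * Re e \<le> n" using sumRe by simp
    then have "Re z \<le> 1/2" using n by (simp add: z_def field_simps)
    moreover have "0 \<le> Re z" using bounds(1)[OF e] n by (simp add: z_def)
    moreover have "(Im z)^2 \<le> 511/1000"
    proof -
      have "(Im e)^2 * 20000 \<le> (real n)^2 * 10201"
        using bounds(2)[OF e] by (simp add: power_divide power_mult_distrib)
      moreover have "(real n)^2 \<ge> 0" by simp
      ultimately have "(Im e)^2 * 1000 \<le> (real n)^2 * 511" by linarith
      then show ?thesis using n by (simp add: z_def power_divide field_simps)
    qed
    ultimately have "Re (z ^ l) \<le> Re z" using l by (intro Re_power_le) auto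
    then have "real n ^ l * Re (z ^ l) \<le> real n ^ l * Re z" using n by (intro mult_left_mono) auto
    moreover have "real n ^ l * Re (z ^ l) = Re (e ^ l)"
    proof -
      have "e ^ l = of_real (real n ^ l) * z ^ l" unfolding ez power_mult_distrib by simp
      then show ?thesis by (simp only: Re_complex_of_real Im_complex_of_real times_complex.simps)
    qed
    moreover have "real n ^ l * Re z = real n ^ (l-1) * Re e"
      unfolding ez using l by (cases l) auto
    ultimately show ?thesis by simp
  qed
  have "Re (mtrace (?A ^\<^sub>m l)) = (\<Sum>e\<leftarrow>es. Re (e ^ l))" by (simp add: tr Re_sum_list)
  also have "\<dots> \<le> (\<Sum>e\<leftarrow>es. real n ^ (l-1) * Re e)" by (intro sum_list_mono key)
  also have "\<dots> = real n ^ (l-1) * real n" by (simp add: sum_list_const_mult sumRe)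
  also have "\<dots> = real n ^ l" using l by (cases l) auto
  finally show ?thesis .
qed

section \<open>Sums over closed walks\<close>

text \<open>Vertices are given by a function on positions, so that one formula serves both words,
  through \<open>(!) vs\<close>, and points of a product space.\<close>

definition cycle_prod :: "('a \<Rightarrow> 'a \<Rightarrow> real) \<Rightarrow> nat \<Rightarrow> (nat \<Rightarrow> 'a) \<Rightarrow> real" where
  "cycle_prod K l x = (\<Prod>i<l. K (x i) (x (Suc i mod l)))"

definition path_prod :: "('a \<Rightarrow> 'a \<Rightarrow> real) \<Rightarrow> nat \<Rightarrow> (nat \<Rightarrow> 'a) \<Rightarrow> real" where
  "path_prod K m x = (\<Prod>i<m. K (x i) (x (Suc i)))"

lemma cycle_prod_Suc: "cycle_prod K (Suc m) x = path_prod K m x * K (x m) (x 0)"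
  unfolding cycle_prod_def path_prod_def by (simp add: lessThan_Suc mult.commute)

lemma path_prod_Suc: "path_prod K (Suc m) x = path_prod K m x * K (x m) (x (Suc m))"
  unfolding path_prod_def by (simp add: mult.commute)

definition words :: "nat \<Rightarrow> nat \<Rightarrow> nat list set" where
  "words n l = {vs. set vs \<subseteq> {..<n} \<and> length vs = l}"

lemma finite_words [simp]: "finite (words n l)" and card_words: "card (words n l) = n ^ l"
  unfolding words_def by (simp_all add: finite_lists_length_eq card_lists_length_eq)

lemma words_0: "words n 0 = {[]}"
  by (auto simp: words_def)

lemma sum_words_Suc: "(\<Sum>vs\<in>words n (Suc l). f vs) = (\<Sum>vs\<in>words n l. \<Sum>x<n. f (x # vs))"
proof -
  have "words n (Suc l) = (\<lambda>(vs, x). x # vs) ` (words n l \<times> {..<n})"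
    unfolding words_def by (rule lists_length_Suc_eq)
  moreover have "inj_on (\<lambda>(vs, x). x # vs) (words n l \<times> {..<n})" by (auto simp: inj_on_def)
  ultimately have "(\<Sum>vs\<in>words n (Suc l). f vs) = (\<Sum>(vs, x)\<in>words n l \<times> {..<n}. f (x # vs))"
    by (simp only: sum.reindex) (simp add: case_prod_beta)
  then show ?thesis by (simp add: sum.cartesian_product)
qed

lemma pow_mat_comm:
  fixes A :: "'a::comm_ring_1 mat"
  assumes A: "A \<in> carrier_mat n n"
  shows "A * A ^\<^sub>m k = A ^\<^sub>m k * A"
proof (induction k)
  case 0 then show ?case using A by simp
next
  case (Suc k)
  have "A * (A ^\<^sub>m k * A) = (A * A ^\<^sub>m k) * A"
    using A by (subst assoc_mult_mat[of _ n n _ n _ n]) auto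
  then show ?case using Suc by simp
qed

lemma rmat_mult: "rmat n g * rmat n a = rmat n (\<lambda>i j. \<Sum>k<n. g i k * a k j)"
  by (rule eq_matI) (auto simp: rmat_def scalar_prod_def lessThan_atLeast0)

text \<open>A trace is a sum over closed walks. The closing step has its own matrix
  \<open>g\<close>, left arbitrary in the induction: summing out the first vertex turns
  \<open>g\<close> into the matrix product of \<open>g\<close> and \<open>a\<close>.\<close>

lemma sum_words_path_prod:
  "of_real (\<Sum>vs\<in>words n (Suc m). path_prod a m ((!) vs) * g (vs ! m) (vs ! 0))
     = mtrace (rmat n g * rmat n a ^\<^sub>m m)"
proof (induction m arbitrary: g)
  case 0
  have "(\<Sum>vs\<in>words n (Suc 0). path_prod a 0 ((!) vs) * g (vs ! 0) (vs ! 0)) = (\<Sum>i<n. g i i)"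
    by (subst sum_words_Suc) (simp add: path_prod_def words_0)
  moreover have "rmat n g * rmat n a ^\<^sub>m 0 = rmat n g" by (simp add: rmat_def)
  ultimately show ?case by (simp add: mtrace_def rmat_def)
next
  case (Suc m)
  have *: "path_prod a (Suc m) ((!) (x # vs)) = a x (vs ! 0) * path_prod a m ((!) vs)" for x vs
    unfolding path_prod_def by (subst prod.lessThan_Suc_shift) simp
  have "(\<Sum>vs\<in>words n (Suc (Suc m)). path_prod a (Suc m) ((!) vs) * g (vs ! Suc m) (vs ! 0))
     = (\<Sum>vs\<in>words n (Suc m). path_prod a m ((!) vs) * (\<Sum>x<n. g (vs ! m) x * a x (vs ! 0)))"
    by (subst sum_words_Suc) (simp add: * sum_distrib_left mult_ac)
  then have "of_real (\<Sum>vs\<in>words n (Suc (Suc m)). path_prod a (Suc m) ((!) vs) * g (vs ! Suc m) (vs ! 0))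
     = mtrace (rmat n g * rmat n a * rmat n a ^\<^sub>m m)"
    using Suc[of "\<lambda>i j. \<Sum>k<n. g i k * a k j"] by (simp only: rmat_mult)
  also have "rmat n g * rmat n a * rmat n a ^\<^sub>m m = rmat n g * rmat n a ^\<^sub>m Suc m"
    using pow_mat_comm[OF rmat_carrier, of n a m]
    by (simp add: assoc_mult_mat[of _ n n _ n _ n])
  finally show ?case .
qed

text \<open>The finite inequality behind both halves of the theorem: \<open>a\<close> will be a
  kernel evaluated at sampled points, and later twice the adjacency matrix of a tournament with 1 on
  the diagonal.\<close>

lemma sum_words_cycle_prod_le:
  fixes a :: "nat \<Rightarrow> nat \<Rightarrow> real"
  assumes sym: "\<And>i j. i < n \<Longrightarrow> j < n \<Longrightarrow> a i j + a j i = 2"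
    and bd: "\<And>i j. i < n \<Longrightarrow> j < n \<Longrightarrow> \<bar>a i j - 1\<bar> \<le> 101/100"
    and l: "l \<ge> 6" "l mod 4 = 2"
  shows "(\<Sum>vs\<in>words n l. cycle_prod a l ((!) vs)) \<le> real n ^ l"
proof -
  obtain m where m: "l = Suc m" using l by (cases l) auto
  have "complex_of_real (\<Sum>vs\<in>words n l. cycle_prod a l ((!) vs)) = mtrace (rmat n a * rmat n a ^\<^sub>m m)"
    unfolding m cycle_prod_Suc by (rule sum_words_path_prod)
  also have "rmat n a * rmat n a ^\<^sub>m m = rmat n a ^\<^sub>m l"
    unfolding m by (simp add: pow_mat_comm[OF rmat_carrier])
  finally have "(\<Sum>vs\<in>words n l. cycle_prod a l ((!) vs)) = Re (mtrace (rmat n a ^\<^sub>m l))"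
    by (metis Re_complex_of_real)
  also have "\<dots> \<le> real n ^ l" by (rule mtrace_rmat_pow_le[OF sym bd l])
  finally show ?thesis .
qed

section \<open>Counting words with distinct letters\<close>

definition distinct_words :: "nat \<Rightarrow> nat \<Rightarrow> nat list set" where
  "distinct_words n l = {vs \<in> words n l. distinct vs}"

lemma nth_words: "vs \<in> words n l \<Longrightarrow> i < l \<Longrightarrow> vs ! i < n"
  using nth_mem[of i vs] unfolding words_def by blast

lemma finite_distinct_words [simp]: "finite (distinct_words n l)"
  by (simp add: distinct_words_def)

lemma card_distinct_words:
  assumes "l \<le> n" shows "card (distinct_words n l) = \<Prod>{n - l + 1..n}"
proof -
  have "distinct_words n l = {xs. length xs = l \<and> distinct xs \<and> set xs \<subseteq> {..<n}}"
    by (auto simp: distinct_words_def words_def)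
  then show ?thesis using card_lists_distinct_length_eq[of "{..<n}" l] assms by simp
qed

lemma card_distinct_words_fact:
  assumes "l \<le> n" shows "real (card (distinct_words n l)) = fact l * real (n choose l)"
proof -
  have "real (card (distinct_words n l)) = real (fact n div fact (n - l))"
    using assms by (simp add: card_distinct_words fact_div_fact)
  also have "\<dots> = fact n / fact (n - l)"
    using fact_dvd[of "n - l" n, where 'a = nat] by (simp add: real_of_nat_div)
  also have "\<dots> = fact l * real (n choose l)"
    using assms by (simp add: binomial_fact)
  finally show ?thesis .
qed

text \<open>Repeated letters are negligible in the limit. This closes the sampling argument and also
  the comparison of \<open>n ^ l\<close> with \<open>fact l * (n choose l)\<close>.\<close>

lemma card_distinct_words_limit: "(\<lambda>n. real (card (distinct_words n l)) / real n ^ l) \<longlonglongrightarrow> 1"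
proof -
  have "(\<lambda>n. \<Prod>i<l. (real n - real i) / real n) \<longlonglongrightarrow> (\<Prod>i<l. 1)"
  proof (rule tendsto_prod)
    fix i
    have "(\<lambda>n. 1 - real i / real n) \<longlonglongrightarrow> 1 - 0"
      by (intro tendsto_intros lim_const_over_n)
    moreover have "\<forall>\<^sub>F n in sequentially. 1 - real i / real n = (real n - real i) / real n"
      using eventually_gt_at_top[of 0] by eventually_elim (simp add: field_simps)
    ultimately show "(\<lambda>n. (real n - real i) / real n) \<longlonglongrightarrow> 1"
      by (auto elim: Lim_transform_eventually)
  qed
  moreover have "\<forall>\<^sub>F n in sequentially. (\<Prod>i<l. (real n - real i) / real n) = real (card (distinct_words n l)) / real n ^ l"
    using eventually_ge_at_top[of l]
  proof eventually_elim
    case (elim n)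
    have "\<Prod>{n - l + 1..n} = (\<Prod>i<l. n - i)"
      by (rule prod.reindex_bij_witness[of _ "\<lambda>i. n - i" "\<lambda>j. n - j"]) (use elim in auto)
    moreover have "real (\<Prod>i<l. n - i) = (\<Prod>i<l. real n - real i)"
      using elim by (simp add: of_nat_diff)
    ultimately have "real (card (distinct_words n l)) = (\<Prod>i<l. real n - real i)"
      using elim by (simp only: card_distinct_words)
    then show ?case by (simp add: prod_dividef)
  qed
  ultimately show ?thesis by (auto elim: Lim_transform_eventually)
qed

section \<open>Bounded kernels on a probability space\<close>

context prob_space
begin

text \<open>Boundedness on a probability space makes all integrals of products of kernels finite, so
  that composition is associative at every point of the space and not only almost
  everywhere.\<close>

definition kernel :: "('a \<Rightarrow> 'a \<Rightarrow> real) \<Rightarrow> bool" where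
  "kernel K \<longleftrightarrow> case_prod K \<in> borel_measurable (M \<Otimes>\<^sub>M M) \<and>
     (\<exists>B. \<forall>x\<in>space M. \<forall>y\<in>space M. \<bar>K x y\<bar> \<le> B)"

lemma kernel_measurable:
  assumes "kernel K" "f \<in> N \<rightarrow>\<^sub>M M" "g \<in> N \<rightarrow>\<^sub>M M"
  shows "(\<lambda>z. K (f z) (g z)) \<in> borel_measurable N"
  using measurable_compose[OF measurable_Pair[OF assms(2,3)], of "case_prod K" borel] assms(1)
  by (simp add: kernel_def)

lemma kernel_bound:
  assumes "kernel K"
  obtains B where "B \<ge> 0" "\<And>x y. x \<in> space M \<Longrightarrow> y \<in> space M \<Longrightarrow> \<bar>K x y\<bar> \<le> B"
proof -
  obtain B where B: "\<forall>x\<in>space M. \<forall>y\<in>space M. \<bar>K x y\<bar> \<le> B" using assms by (auto simp: kernel_def)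
  obtain x where "x \<in> space M" using not_empty by blast
  with B have "B \<ge> 0" by (meson abs_ge_zero order.trans)
  with B that show ?thesis by blast
qed

lemma kernelI:
  assumes "case_prod K \<in> borel_measurable (M \<Otimes>\<^sub>M M)"
    and "\<And>x y. x \<in> space M \<Longrightarrow> y \<in> space M \<Longrightarrow> \<bar>K x y\<bar> \<le> B"
  shows "kernel K"
  using assms unfolding kernel_def by blast

lemma kernel_const: "kernel (\<lambda>x y. c)"
  by (rule kernelI[of _ "\<bar>c\<bar>"]) auto

lemma kernel_mult:
  assumes K: "kernel K" and L: "kernel L" shows "kernel (\<lambda>x y. K x y * L x y)"
proof -
  obtain B where B: "\<And>x y. x \<in> space M \<Longrightarrow> y \<in> space M \<Longrightarrow> \<bar>K x y\<bar> \<le> B" "B \<ge> 0" using kernel_bound[OF K] by metis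
  obtain C where C: "\<And>x y. x \<in> space M \<Longrightarrow> y \<in> space M \<Longrightarrow> \<bar>L x y\<bar> \<le> C" using kernel_bound[OF L] by metis
  show ?thesis
  proof (rule kernelI[of _ "B * C"])
    show "(\<lambda>(x,y). K x y * L x y) \<in> borel_measurable (M \<Otimes>\<^sub>M M)"
      using K L unfolding case_prod_beta by (intro borel_measurable_times kernel_measurable) auto
  qed (auto simp: abs_mult intro!: mult_mono B C)
qed

lemma kernel_add:
  assumes K: "kernel K" and L: "kernel L" shows "kernel (\<lambda>x y. K x y + L x y)"
proof -
  obtain B where B: "\<And>x y. x \<in> space M \<Longrightarrow> y \<in> space M \<Longrightarrow> \<bar>K x y\<bar> \<le> B" using kernel_bound[OF K] by metis
  obtain C where C: "\<And>x y. x \<in> space M \<Longrightarrow> y \<in> space M \<Longrightarrow> \<bar>L x y\<bar> \<le> C" using kernel_bound[OF L] by metis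
  show ?thesis
  proof (rule kernelI[of _ "B + C"])
    show "(\<lambda>(x,y). K x y + L x y) \<in> borel_measurable (M \<Otimes>\<^sub>M M)"
      using K L unfolding case_prod_beta by (intro borel_measurable_add kernel_measurable) auto
  qed (use B C in \<open>auto intro!: order.trans[OF abs_triangle_ineq] add_mono\<close>)
qed

lemma kernel_cmult: "kernel K \<Longrightarrow> kernel (\<lambda>x y. c * K x y)"
  using kernel_mult[OF kernel_const] by blast

lemma kernel_diff: "kernel K \<Longrightarrow> kernel L \<Longrightarrow> kernel (\<lambda>x y. K x y - L x y)"
  using kernel_add[of K "\<lambda>x y. (-1) * L x y"] kernel_cmult[of L "-1"] by simp

lemma kernel_transpose: "kernel K \<Longrightarrow> kernel (\<lambda>x y. K y x)"
proof -
  assume K: "kernel K"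
  obtain B where B: "\<And>x y. x \<in> space M \<Longrightarrow> y \<in> space M \<Longrightarrow> \<bar>K x y\<bar> \<le> B" using kernel_bound[OF K] by metis
  show ?thesis
    using K by (intro kernelI[of _ B] B) (auto simp: case_prod_unfold intro!: kernel_measurable)
qed

lemma kernel_integrable_right: "kernel K \<Longrightarrow> x \<in> space M \<Longrightarrow> integrable M (\<lambda>y. K x y)"
proof -
  assume K: "kernel K" and x: "x \<in> space M"
  obtain B where B: "\<And>x y. x \<in> space M \<Longrightarrow> y \<in> space M \<Longrightarrow> \<bar>K x y\<bar> \<le> B" using kernel_bound[OF K] by metis
  show ?thesis
    using K x by (intro integrable_const_bound[of _ B] AE_I2 kernel_measurable) (auto intro: B)
qed

lemma kernel_integrable_left: "kernel K \<Longrightarrow> x \<in> space M \<Longrightarrow> integrable M (\<lambda>y. K y x)"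
  using kernel_integrable_right[OF kernel_transpose] .

lemma kernel_integrable_pair: "kernel K \<Longrightarrow> integrable (M \<Otimes>\<^sub>M M) (case_prod K)"
proof -
  assume K: "kernel K"
  interpret MM: pair_prob_space M M ..
  obtain B where B: "\<And>x y. x \<in> space M \<Longrightarrow> y \<in> space M \<Longrightarrow> \<bar>K x y\<bar> \<le> B" using kernel_bound[OF K] by metis
  show ?thesis
    using K by (intro MM.integrable_const_bound[of _ B] AE_I2) (auto simp: kernel_def space_pair_measure B)
qed

lemma kernel_Fubini: "kernel K \<Longrightarrow> (\<integral>x. \<integral>y. K x y \<partial>M \<partial>M) = (\<integral>y. \<integral>x. K x y \<partial>M \<partial>M)"
proof -
  assume K: "kernel K"
  interpret MM: pair_prob_space M M ..
  show ?thesis using MM.Fubini_integral[OF kernel_integrable_pair[OF K]] by simp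
qed

lemma kernel_integral_pair: "kernel K \<Longrightarrow> (\<integral>x. \<integral>y. K x y \<partial>M \<partial>M) = (\<integral>z. K (fst z) (snd z) \<partial>(M \<Otimes>\<^sub>M M))"
proof -
  assume K: "kernel K"
  interpret MM: pair_prob_space M M ..
  show ?thesis using MM.integral_fst[OF kernel_integrable_pair[OF K]] by (simp add: case_prod_unfold)
qed

lemma kernel_integral_measurable:
  assumes "kernel K" shows "(\<lambda>x. \<integral>y. K x y \<partial>M) \<in> borel_measurable M"
  using assms by (intro borel_measurable_lebesgue_integral) (simp add: kernel_def)

lemma integral_bound:
  assumes "\<And>y. y \<in> space M \<Longrightarrow> \<bar>f y\<bar> \<le> B" and "B \<ge> 0"
  shows "\<bar>\<integral>y. f y \<partial>M\<bar> \<le> (B::real)"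
proof (cases "integrable M f")
  case True
  have "\<bar>\<integral>y. f y \<partial>M\<bar> \<le> (\<integral>y. \<bar>f y\<bar> \<partial>M)" by (rule integral_abs_bound)
  also have "\<dots> \<le> (\<integral>y. B \<partial>M)" using True assms by (intro integral_mono) auto
  finally show ?thesis by (simp add: prob_space)
qed (simp add: not_integrable_integral_eq assms)

lemma kernel_integrable_integral:
  assumes "kernel K" shows "integrable M (\<lambda>x. \<integral>y. K x y \<partial>M)"
proof -
  obtain B where "\<And>x y. x \<in> space M \<Longrightarrow> y \<in> space M \<Longrightarrow> \<bar>K x y\<bar> \<le> B" "B \<ge> 0" using kernel_bound[OF assms] by metis
  then show ?thesis
    using assms by (intro integrable_const_bound[of _ B] AE_I2 kernel_integral_measurable) (auto intro!: integral_bound)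
qed

section \<open>Composition, trace and powers of kernels\<close>

definition kcomp :: "('a \<Rightarrow> 'a \<Rightarrow> real) \<Rightarrow> ('a \<Rightarrow> 'a \<Rightarrow> real) \<Rightarrow> 'a \<Rightarrow> 'a \<Rightarrow> real" where
  "kcomp K L x y = (\<integral>z. K x z * L z y \<partial>M)"

lemma kernel_mult_section: 
  assumes K: "kernel K" and L: "kernel L" and "x \<in> space M" "y \<in> space M" 
  shows "integrable M (\<lambda>z. K x z * L z y)"
proof -
  obtain B where B: "\<And>x y. x \<in> space M \<Longrightarrow> y \<in> space M \<Longrightarrow> \<bar>K x y\<bar> \<le> B" "B \<ge> 0" using kernel_bound[OF K] by metis
  obtain C where C: "\<And>x y. x \<in> space M \<Longrightarrow> y \<in> space M \<Longrightarrow> \<bar>L x y\<bar> \<le> C" using kernel_bound[OF L] by metis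
  show ?thesis
    using assms
    by (intro integrable_const_bound[of _ "B * C"] AE_I2 borel_measurable_times kernel_measurable)
      (auto simp: abs_mult intro!: mult_mono B C)
qed

lemma kernel_kcomp [intro]:
  assumes K: "kernel K" and L: "kernel L" shows "kernel (kcomp K L)"
proof -
  obtain B where B: "\<And>x y. x \<in> space M \<Longrightarrow> y \<in> space M \<Longrightarrow> \<bar>K x y\<bar> \<le> B" "B \<ge> 0" using kernel_bound[OF K] by metis
  obtain C where C: "\<And>x y. x \<in> space M \<Longrightarrow> y \<in> space M \<Longrightarrow> \<bar>L x y\<bar> \<le> C" "C \<ge> 0" using kernel_bound[OF L] by metis
  show ?thesis
  proof (rule kernelI[of _ "B * C"])
    have "(\<lambda>p. \<integral>z. K (fst p) z * L z (snd p) \<partial>M) \<in> borel_measurable (M \<Otimes>\<^sub>M M)"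
      using K L by (intro borel_measurable_lebesgue_integral) 
        (auto simp: case_prod_unfold intro!: borel_measurable_times kernel_measurable)
    then show "case_prod (kcomp K L) \<in> borel_measurable (M \<Otimes>\<^sub>M M)"
      by (simp add: kcomp_def case_prod_unfold)
    show "\<bar>kcomp K L x y\<bar> \<le> B * C" if "x \<in> space M" "y \<in> space M" for x y
      unfolding kcomp_def using that B C
      by (intro integral_bound) (auto simp: abs_mult intro!: mult_mono)
  qed
qed

text \<open>The trace of the composition of two kernels. With two factors it depends on each kernel
  only up to a null set of the product, unlike the integral of one kernel over the diagonal.\<close>

definition ktrace :: "('a \<Rightarrow> 'a \<Rightarrow> real) \<Rightarrow> ('a \<Rightarrow> 'a \<Rightarrow> real) \<Rightarrow> real" where
  "ktrace K L = (\<integral>x. \<integral>y. K x y * L y x \<partial>M \<partial>M)"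

lemma ktrace_commute: "kernel K \<Longrightarrow> kernel L \<Longrightarrow> ktrace K L = ktrace L K"
proof -
  assume "kernel K" "kernel L"
  then show ?thesis unfolding ktrace_def
    using kernel_Fubini[OF kernel_mult[OF \<open>kernel K\<close> kernel_transpose[OF \<open>kernel L\<close>]]]
    by (simp add: mult.commute)
qed

text \<open>The integrand of a triple composition with both end points fixed;
  \<open>kcomp_assoc\<close> is Fubini for it.\<close>

lemma kernel_slice:
  assumes "kernel K" "kernel L" "kernel N" and x: "x \<in> space M" "w \<in> space M"
  shows "kernel (\<lambda>y z. K x z * L z y * N y w)"
proof -
  obtain B where B: "\<And>x y. x \<in> space M \<Longrightarrow> y \<in> space M \<Longrightarrow> \<bar>K x y\<bar> \<le> B" using kernel_bound[OF assms(1)] by metis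
  obtain C where C: "\<And>x y. x \<in> space M \<Longrightarrow> y \<in> space M \<Longrightarrow> \<bar>N x y\<bar> \<le> C" using kernel_bound[OF assms(3)] by metis
  have 1: "kernel (\<lambda>y z. K x z)" 
    using assms by (intro kernelI[of _ B] B) (auto simp: case_prod_unfold intro!: kernel_measurable)
  have 2: "kernel (\<lambda>y z. N y w)" 
    using assms by (intro kernelI[of _ C] C) (auto simp: case_prod_unfold intro!: kernel_measurable)
  show ?thesis by (rule kernel_mult[OF kernel_mult[OF 1 kernel_transpose[OF assms(2)]] 2])
qed

lemma kcomp_assoc:
  assumes "kernel K" "kernel L" "kernel N" and x: "x \<in> space M" "w \<in> space M"
  shows "kcomp (kcomp K L) N x w = kcomp K (kcomp L N) x w"
proof -
  have "kcomp (kcomp K L) N x w = (\<integral>y. \<integral>z. K x z * L z y * N y w \<partial>M \<partial>M)"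
    by (simp add: kcomp_def)
  also have "\<dots> = (\<integral>z. \<integral>y. K x z * L z y * N y w \<partial>M \<partial>M)"
    using assms by (intro kernel_Fubini kernel_slice)
  also have "\<dots> = kcomp K (kcomp L N) x w"
    by (simp add: kcomp_def mult.assoc)
  finally show ?thesis .
qed

lemma ktrace_kcomp:
  assumes "kernel K" "kernel L" "kernel N"
  shows "ktrace (kcomp K L) N = ktrace K (kcomp L N)"
proof -
  have "(\<integral>y. kcomp K L x y * N y x \<partial>M) = (\<integral>y. K x y * kcomp L N y x \<partial>M)" if "x \<in> space M" for x
    using kcomp_assoc[OF assms that that] by (simp add: kcomp_def)
  then show ?thesis unfolding ktrace_def by (rule Bochner_Integration.integral_cong[OF refl])
qed

lemma ktrace_cong:
  assumes "\<And>x y. x \<in> space M \<Longrightarrow> y \<in> space M \<Longrightarrow> K x y = K' x y"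
    and "\<And>x y. x \<in> space M \<Longrightarrow> y \<in> space M \<Longrightarrow> L x y = L' x y"
  shows "ktrace K L = ktrace K' L'"
  unfolding ktrace_def using assms by (intro Bochner_Integration.integral_cong refl) auto

lemma kcomp_cong:
  assumes "\<And>x y. x \<in> space M \<Longrightarrow> y \<in> space M \<Longrightarrow> K x y = K' x y"
    and "\<And>x y. x \<in> space M \<Longrightarrow> y \<in> space M \<Longrightarrow> L x y = L' x y"
    and "x \<in> space M" "y \<in> space M"
  shows "kcomp K L x y = kcomp K' L' x y"
  unfolding kcomp_def using assms by (intro Bochner_Integration.integral_cong refl) auto

text \<open>There is no identity kernel, so the indices are shifted: \<open>kpow K m\<close> is the power \<open>K ^ (m + 1)\<close>.\<close>

primrec kpow :: "('a \<Rightarrow> 'a \<Rightarrow> real) \<Rightarrow> nat \<Rightarrow> 'a \<Rightarrow> 'a \<Rightarrow> real" where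
  "kpow K 0 = K"
| "kpow K (Suc m) = kcomp (kpow K m) K"

lemma kernel_kpow [intro]: "kernel K \<Longrightarrow> kernel (kpow K m)"
  by (induction m) auto

text \<open>The exponents meant are \<open>m + 1\<close> and \<open>n + 1\<close>; their sum
  \<open>m + n + 2\<close> is denoted by the index \<open>Suc (m + n)\<close>.\<close>

lemma kpow_add:
  assumes "kernel K" and "x \<in> space M" "y \<in> space M"
  shows "kcomp (kpow K m) (kpow K n) x y = kpow K (Suc (m + n)) x y"
  using assms(2,3)
proof (induction n arbitrary: x y)
  case (Suc n)
  have "kcomp (kpow K m) (kpow K (Suc n)) x y = kcomp (kcomp (kpow K m) (kpow K n)) K x y"
    using Suc.prems assms(1) by (simp add: kcomp_assoc kernel_kpow)
  also have "\<dots> = kcomp (kpow K (Suc (m + n))) K x y"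
    using Suc by (intro kcomp_cong) auto
  finally show ?case by simp
qed simp

section \<open>Cycle integrals and the upper bound by sampling\<close>

definition cycle_integral :: "('a \<Rightarrow> 'a \<Rightarrow> real) \<Rightarrow> nat \<Rightarrow> real" where
  "cycle_integral K l = (\<integral>x. cycle_prod K l x \<partial>(\<Pi>\<^sub>M i\<in>{..<l}. M))"

lemma cycle_prod_measurable:
  assumes "kernel K" and "\<And>i. i < l \<Longrightarrow> (\<lambda>z. f z i) \<in> N \<rightarrow>\<^sub>M M"
  shows "(\<lambda>z. cycle_prod K l (f z)) \<in> borel_measurable N"
  unfolding cycle_prod_def using assms
  by (intro borel_measurable_prod kernel_measurable) auto

lemma cycle_prod_bound:
  assumes "\<And>x y. x \<in> space M \<Longrightarrow> y \<in> space M \<Longrightarrow> \<bar>K x y\<bar> \<le> B"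
    and "\<And>i. i < l \<Longrightarrow> x i \<in> space M"
  shows "\<bar>cycle_prod K l x\<bar> \<le> B ^ l"
proof -
  have "\<bar>cycle_prod K l x\<bar> = (\<Prod>i<l. \<bar>K (x i) (x (Suc i mod l))\<bar>)"
    by (simp add: cycle_prod_def abs_prod)
  also have "\<dots> \<le> (\<Prod>i<l. B)"
    using assms by (intro prod_mono conjI abs_ge_zero) auto
  finally show ?thesis by simp
qed

text \<open>The last vertex is integrated out and absorbed in the closing kernel \<open>g\<close>,
  which is therefore arbitrary in the induction. For \<open>m = 0\<close> a single vertex is left,
  and with it only the diagonal of \<open>g\<close>.\<close>

lemma path_prod_integral:
  assumes K: "kernel K" and "kernel g"
  shows "(\<integral>x. path_prod K m x * g (x m) (x 0) \<partial>(\<Pi>\<^sub>M i\<in>{..<Suc m}. M))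
     = (if m = 0 then (\<integral>x. g x x \<partial>M) else ktrace (kpow K (m - 1)) g)"
  using assms(2)
proof (induction m arbitrary: g)
  case 0
  interpret product_sigma_finite "\<lambda>i::nat. M" ..
  have e: "{..<Suc 0} = {0::nat}" by auto
  have "(\<lambda>x. g x x) \<in> borel_measurable M" using 0 by (intro kernel_measurable) auto
  from product_integral_singleton[OF this, of 0] show ?case
    unfolding e path_prod_def by simp
next
  case (Suc m)
  interpret product_sigma_finite "\<lambda>i::nat. M" ..
  interpret PP: prob_space "\<Pi>\<^sub>M i\<in>{..<Suc (Suc m)}. M" by (intro prob_space_PiM prob_space_axioms)
  obtain B where B: "\<And>x y. x \<in> space M \<Longrightarrow> y \<in> space M \<Longrightarrow> \<bar>K x y\<bar> \<le> B" "B \<ge> 0" using kernel_bound[OF K] by metis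
  obtain C where C: "\<And>x y. x \<in> space M \<Longrightarrow> y \<in> space M \<Longrightarrow> \<bar>g x y\<bar> \<le> C" "C \<ge> 0" using kernel_bound[OF Suc.prems] by metis
  let ?f = "\<lambda>x. path_prod K (Suc m) x * g (x (Suc m)) (x 0)"
  have int: "integrable (\<Pi>\<^sub>M i\<in>{..<Suc (Suc m)}. M) ?f"
  proof (rule PP.integrable_const_bound[of _ "B ^ Suc m * C"])
    show "?f \<in> borel_measurable (\<Pi>\<^sub>M i\<in>{..<Suc (Suc m)}. M)"
      unfolding path_prod_def using K Suc.prems
      by (intro borel_measurable_times borel_measurable_prod kernel_measurable) auto
    show "AE x in \<Pi>\<^sub>M i\<in>{..<Suc (Suc m)}. M. norm (?f x) \<le> B ^ Suc m * C"
    proof (intro AE_I2)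
      fix x assume "x \<in> space (\<Pi>\<^sub>M i\<in>{..<Suc (Suc m)}. M)"
      then have x: "x i \<in> space M" if "i < Suc (Suc m)" for i using that by (auto simp: space_PiM PiE_iff)
      have "\<bar>path_prod K (Suc m) x\<bar> = (\<Prod>i<Suc m. \<bar>K (x i) (x (Suc i))\<bar>)"
        unfolding path_prod_def by (rule abs_prod)
      also have "\<dots> \<le> (\<Prod>i<Suc m. B)"
        using x by (intro prod_mono conjI abs_ge_zero B) auto
      also have "\<dots> = B ^ Suc m" by simp
      finally have "\<bar>path_prod K (Suc m) x\<bar> \<le> B ^ Suc m" .
      moreover have "\<bar>g (x (Suc m)) (x 0)\<bar> \<le> C" using x by (intro C) auto
      ultimately show "norm (?f x) \<le> B ^ Suc m * C"
        unfolding real_norm_def abs_mult by (intro mult_mono zero_le_power B(2) abs_ge_zero)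
    qed
  qed
  have "(\<integral>x. ?f x \<partial>(\<Pi>\<^sub>M i\<in>{..<Suc (Suc m)}. M)) = (\<integral>x. ?f x \<partial>(\<Pi>\<^sub>M i\<in>insert (Suc m) {..<Suc m}. M))"
    by (simp only: lessThan_Suc)
  also have "\<dots> = (\<integral>x. (\<integral>y. ?f (x(Suc m := y)) \<partial>M) \<partial>(\<Pi>\<^sub>M i\<in>{..<Suc m}. M))"
    by (rule product_integral_insert) (use int in \<open>simp_all only: lessThan_Suc, simp_all\<close>)
  also have "\<dots> = (\<integral>x. path_prod K m x * kcomp K g (x m) (x 0) \<partial>(\<Pi>\<^sub>M i\<in>{..<Suc m}. M))"
  proof -
    have "path_prod K (Suc m) (x(Suc m := y)) = path_prod K m x * K (x m) y" for x y
    proof -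
      have "path_prod K m (x(Suc m := y)) = path_prod K m x"
        unfolding path_prod_def by (intro prod.cong) auto
      then show ?thesis by (simp add: path_prod_Suc)
    qed
    then show ?thesis by (simp add: kcomp_def mult.assoc)
  qed
  also have "\<dots> = (if m = 0 then (\<integral>x. kcomp K g x x \<partial>M) else ktrace (kpow K (m - 1)) (kcomp K g))"
    by (rule Suc.IH) (use K \<open>kernel g\<close> in auto)
  also have "\<dots> = ktrace (kpow K m) g"
    using K \<open>kernel g\<close> by (cases m) (simp_all add: ktrace_def[of K] kcomp_def[of K] ktrace_kcomp kernel_kpow)
  finally show ?case by simp
qed

lemma cycle_integral_ktrace:
  assumes K: "kernel K"
  shows "cycle_integral K (Suc (Suc m)) = ktrace (kpow K m) K"
  unfolding cycle_integral_def cycle_prod_Suc using path_prod_integral[OF K K, of "Suc m"]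
  by (simp only: nat.distinct if_False diff_Suc_1)

text \<open>Distinct letters select distinct coordinates, and these are independent with law
  \<open>M\<close>.\<close>

lemma cycle_integral_reindex:
  assumes K: "kernel K" and vs: "vs \<in> distinct_words n l"
  shows "(\<integral>x. cycle_prod K l (\<lambda>i. x (vs ! i)) \<partial>(\<Pi>\<^sub>M i\<in>{..<n}. M)) = cycle_integral K l"
proof -
  have inj: "inj_on ((!) vs) {..<l}" and into: "(!) vs \<in> {..<l} \<rightarrow> {..<n}"
    using vs nth_mem by (fastforce simp: distinct_words_def words_def inj_on_def nth_eq_iff_index_eq)+
  let ?t = "\<lambda>x. \<lambda>i\<in>{..<l}. x (vs ! i)"
  have "distr (\<Pi>\<^sub>M i\<in>{..<n}. M) (\<Pi>\<^sub>M i\<in>{..<l}. M) ?t = (\<Pi>\<^sub>M i\<in>{..<l}. M)"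
    using distr_PiM_reindex[OF _ inj into, of "\<lambda>_. M"] prob_space_axioms by simp
  then have "cycle_integral K l = (\<integral>x. cycle_prod K l x \<partial>distr (\<Pi>\<^sub>M i\<in>{..<n}. M) (\<Pi>\<^sub>M i\<in>{..<l}. M) ?t)"
    by (simp add: cycle_integral_def)
  also have "\<dots> = (\<integral>x. cycle_prod K l (?t x) \<partial>(\<Pi>\<^sub>M i\<in>{..<n}. M))"
  proof (rule integral_distr)
    show "?t \<in> (\<Pi>\<^sub>M i\<in>{..<n}. M) \<rightarrow>\<^sub>M (\<Pi>\<^sub>M i\<in>{..<l}. M)"
      using into by (intro measurable_restrict measurable_component_singleton) auto
    show "cycle_prod K l \<in> borel_measurable (\<Pi>\<^sub>M i\<in>{..<l}. M)"
      using K by (intro cycle_prod_measurable[where f="\<lambda>x. x", simplified]) auto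
  qed
  also have "\<dots> = (\<integral>x. cycle_prod K l (\<lambda>i. x (vs ! i)) \<partial>(\<Pi>\<^sub>M i\<in>{..<n}. M))"
    unfolding cycle_prod_def by (intro Bochner_Integration.integral_cong refl prod.cong) auto
  finally show ?thesis by simp
qed

text \<open>\<open>sum_words_cycle_prod_le\<close> is averaged over \<open>n\<close> independent
  points. A word with distinct letters contributes the cycle integral, any other word at least
  \<open>- (B ^ l)\<close>, and the proportion \<open>d n\<close> of the former tends to 1.\<close>

lemma cycle_integral_le_1:
  assumes K: "kernel K"
    and sym: "\<And>x y. x \<in> space M \<Longrightarrow> y \<in> space M \<Longrightarrow> K x y + K y x = 2"
    and bd: "\<And>x y. x \<in> space M \<Longrightarrow> y \<in> space M \<Longrightarrow> \<bar>K x y - 1\<bar> \<le> 101/100"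
    and l: "l \<ge> 6" "l mod 4 = 2"
  shows "cycle_integral K l \<le> 1"
proof -
  define c where "c = cycle_integral K l"
  define d where "d n = real (card (distinct_words n l)) / real n ^ l" for n
  \<comment> \<open>Any number from \<open>1 + 101/100\<close> upwards bounds
    \<open>\<bar>K x y\<bar>\<close>.\<close>
  define B :: real where "B = 3"
  have B: "\<bar>K x y\<bar> \<le> B" if "x \<in> space M" "y \<in> space M" for x y
    using bd[OF that] unfolding B_def by linarith
  have main: "d n * c \<le> 1 + (1 - d n) * B ^ l" if n: "n \<ge> 1" for n
  proof -
    let ?N = "\<Pi>\<^sub>M i\<in>{..<n}. M"
    interpret N: prob_space ?N by (intro prob_space_PiM prob_space_axioms)
    define f where "f vs x = cycle_prod K l (\<lambda>i. x (vs ! i))" for vs and x :: "nat \<Rightarrow> 'a"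
    have xs: "x (vs ! i) \<in> space M" if "x \<in> space ?N" "vs \<in> words n l" "i < l" for x vs i
      using that nth_words[of vs n l i] by (auto simp: space_PiM PiE_iff)
    have fb: "\<bar>f vs x\<bar> \<le> B ^ l" if "x \<in> space ?N" "vs \<in> words n l" for x vs
      unfolding f_def using xs[OF that] B by (intro cycle_prod_bound) auto
    have fi: "integrable ?N (f vs)" if "vs \<in> words n l" for vs
    proof (rule N.integrable_const_bound[of _ "B ^ l"])
      show "AE x in ?N. norm (f vs x) \<le> B ^ l" using fb that by (intro AE_I2) auto
      have "vs ! i \<in> {..<n}" if "i < l" for i using \<open>vs \<in> words n l\<close> that by (simp add: nth_words)
      then show "f vs \<in> borel_measurable ?N"
        unfolding f_def using K by (intro cycle_prod_measurable measurable_component_singleton) auto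
    qed
    have "(\<Sum>vs\<in>words n l. \<integral>x. f vs x \<partial>?N) = (\<integral>x. (\<Sum>vs\<in>words n l. f vs x) \<partial>?N)"
      using fi by (simp add: Bochner_Integration.integral_sum)
    also have "\<dots> \<le> (\<integral>x. real n ^ l \<partial>?N)"
    proof (rule integral_mono)
      fix x assume "x \<in> space ?N"
      then have x: "x i \<in> space M" if "i < n" for i using that by (auto simp: space_PiM PiE_iff)
      have "(\<Sum>vs\<in>words n l. f vs x) = (\<Sum>vs\<in>words n l. cycle_prod (\<lambda>i j. K (x i) (x j)) l ((!) vs))"
        by (simp add: f_def cycle_prod_def)
      also have "\<dots> \<le> real n ^ l" using sym bd x l by (intro sum_words_cycle_prod_le) auto
      finally show "(\<Sum>vs\<in>words n l. f vs x) \<le> real n ^ l" .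
    qed (use fi in auto)
    also have "\<dots> = real n ^ l" using N.prob_space by simp
    finally have up: "(\<Sum>vs\<in>words n l. \<integral>x. f vs x \<partial>?N) \<le> real n ^ l" .
    have "(\<Sum>vs\<in>words n l. if distinct vs then c else - (B ^ l)) \<le> (\<Sum>vs\<in>words n l. \<integral>x. f vs x \<partial>?N)"
    proof (rule sum_mono)
      fix vs assume vs: "vs \<in> words n l"
      show "(if distinct vs then c else - (B ^ l)) \<le> (\<integral>x. f vs x \<partial>?N)"
      proof (cases "distinct vs")
        case True
        then show ?thesis using cycle_integral_reindex[OF K, of vs n l] vs
          by (simp add: f_def c_def distinct_words_def)
      next
        case False
        have "\<bar>\<integral>x. f vs x \<partial>?N\<bar> \<le> B ^ l" using fb[OF _ vs] by (intro N.integral_bound) (auto simp: B_def)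
        then show ?thesis using False by simp
      qed
    qed
    also have "(\<Sum>vs\<in>words n l. if distinct vs then c else - (B ^ l)) 
      = (\<Sum>vs\<in>words n l. - (B ^ l)) + (\<Sum>vs\<in>words n l. if distinct vs then c + B ^ l else 0)"
      by (subst sum.distrib[symmetric]) (intro sum.cong, auto)
    also have "(\<Sum>vs\<in>words n l. if distinct vs then c + B ^ l else 0) = real (card (distinct_words n l)) * (c + B ^ l)"
      by (simp add: sum.inter_filter[symmetric] distinct_words_def)
    also have "(\<Sum>vs\<in>words n l. - (B ^ l)) = - (real n ^ l * B ^ l)" by (simp add: card_words)
    finally have "- (real n ^ l * B ^ l) + real (card (distinct_words n l)) * (c + B ^ l) \<le> real n ^ l"
      using up by linarith
    then have "(- (real n ^ l * B ^ l) + real (card (distinct_words n l)) * (c + B ^ l)) / real n ^ l \<le> 1"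
      using n by (simp add: divide_le_eq)
    moreover have "(- (real n ^ l * B ^ l) + real (card (distinct_words n l)) * (c + B ^ l)) / real n ^ l
      = - (B ^ l) + d n * (c + B ^ l)" using n by (simp add: d_def diff_divide_distrib)
    ultimately show ?thesis by (simp add: algebra_simps)
  qed
  have d: "d \<longlonglongrightarrow> 1" unfolding d_def by (rule card_distinct_words_limit)
  have "1 * c \<le> 1 + (1 - 1) * B ^ l"
  proof (rule tendsto_le)
    show "(\<lambda>n. d n * c) \<longlonglongrightarrow> 1 * c" "(\<lambda>n. 1 + (1 - d n) * B ^ l) \<longlonglongrightarrow> 1 + (1 - 1) * B ^ l"
      by (intro tendsto_intros d)+
    show "\<forall>\<^sub>F n in sequentially. d n * c \<le> 1 + (1 - d n) * B ^ l"
      using eventually_ge_at_top[of 1] by eventually_elim (rule main)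
  qed simp
  then show ?thesis by (simp add: c_def)
qed

subsection \<open>The equality case\<close>

text \<open>The derivative of \<open>kpow (K + e B) m\<close> with respect to \<open>e\<close> at 0.\<close>

primrec kpow_deriv :: "('a \<Rightarrow> 'a \<Rightarrow> real) \<Rightarrow> ('a \<Rightarrow> 'a \<Rightarrow> real) \<Rightarrow> nat \<Rightarrow> 'a \<Rightarrow> 'a \<Rightarrow> real" where
  "kpow_deriv K B 0 = B"
| "kpow_deriv K B (Suc m) = (\<lambda>x y. kcomp (kpow_deriv K B m) K x y + kcomp (kpow K m) B x y)"

lemma kernel_kpow_deriv: "kernel K \<Longrightarrow> kernel B \<Longrightarrow> kernel (kpow_deriv K B m)"
  by (induction m) (auto intro!: kernel_add)

text \<open>A first-order Taylor formula, by the product rule. The remainder is uniform over all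
  points, so it can also be integrated along the diagonal, as
  \<open>cycle_integral_expansion\<close> does.\<close>

lemma kpow_expansion:
  assumes K: "kernel K" and B: "kernel B"
  shows "\<exists>R\<ge>0. \<forall>e. \<bar>e\<bar> \<le> 1 \<longrightarrow> (\<forall>x\<in>space M. \<forall>y\<in>space M.
     \<bar>kpow (\<lambda>x y. K x y + e * B x y) m x y - kpow K m x y - e * kpow_deriv K B m x y\<bar> \<le> R * e^2)"
proof (induction m)
  case 0
  show ?case by (intro exI[of _ 0]) simp
next
  case (Suc m)
  then obtain R where R0: "R \<ge> 0" and R: "\<And>e x y. \<bar>e\<bar> \<le> 1 \<Longrightarrow> x \<in> space M \<Longrightarrow> y \<in> space M \<Longrightarrow>
     \<bar>kpow (\<lambda>x y. K x y + e * B x y) m x y - kpow K m x y - e * kpow_deriv K B m x y\<bar> \<le> R * e^2"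
    by blast
  let ?D = "kpow_deriv K B m"
  have D: "kernel ?D" and P: "kernel (kpow K m)" using K B by (auto intro: kernel_kpow_deriv)
  obtain k where k: "\<And>x y. x \<in> space M \<Longrightarrow> y \<in> space M \<Longrightarrow> \<bar>K x y\<bar> \<le> k" "k \<ge> 0" using kernel_bound[OF K] by metis
  obtain b where b: "\<And>x y. x \<in> space M \<Longrightarrow> y \<in> space M \<Longrightarrow> \<bar>B x y\<bar> \<le> b" "b \<ge> 0" using kernel_bound[OF B] by metis
  obtain d where d: "\<And>x y. x \<in> space M \<Longrightarrow> y \<in> space M \<Longrightarrow> \<bar>?D x y\<bar> \<le> d" "d \<ge> 0" using kernel_bound[OF D] by metis
  show ?case
  proof (intro exI[of _ "d * b + R * (k + b)"] conjI allI impI ballI)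
    show "0 \<le> d * b + R * (k + b)" using k b d R0 by simp
    fix e :: real and x y assume e: "\<bar>e\<bar> \<le> 1" and xy: "x \<in> space M" "y \<in> space M"
    define L where "L = (\<lambda>x y. K x y + e * B x y)"
    have L: "kernel L" unfolding L_def by (intro kernel_add kernel_cmult K B)
    define E where "E z = kpow L m x z - kpow K m x z - e * ?D x z" for z
    have Eb: "\<bar>E z\<bar> \<le> R * e^2" if "z \<in> space M" for z
      using R[OF e xy(1) that] by (simp add: E_def L_def)
    have Lb: "\<bar>L z y\<bar> \<le> k + b" if "z \<in> space M" for z
    proof -
      have "\<bar>e * B z y\<bar> \<le> 1 * b" unfolding abs_mult using e b that xy by (intro mult_mono) auto
      then show ?thesis using k(1)[OF that xy(2)] unfolding L_def by linarith
    qed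
    have i1: "integrable M (\<lambda>z. kpow L m x z * L z y)" using L xy by (intro kernel_mult_section) auto
    have i2: "integrable M (\<lambda>z. kpow K m x z * K z y)" using K P xy by (intro kernel_mult_section) auto
    have i3: "integrable M (\<lambda>z. ?D x z * K z y)" using K D xy by (intro kernel_mult_section) auto
    have i4: "integrable M (\<lambda>z. kpow K m x z * B z y)" using B P xy by (intro kernel_mult_section) auto
    have "kpow L (Suc m) x y - kpow K (Suc m) x y - e * kpow_deriv K B (Suc m) x y
      = (\<integral>z. kpow L m x z * L z y - kpow K m x z * K z y - e * (?D x z * K z y + kpow K m x z * B z y) \<partial>M)"
      using i1 i2 i3 i4 by (simp add: kcomp_def)
    \<comment> \<open>Multiply \<open>kpow L m = kpow K m + e * ?D + E\<close> by
      \<open>L = K + e * B\<close>: these two products are left after the terms of order at most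
      one. Their bounds make up the constant \<open>d * b + R * (k + b)\<close>.\<close>
    also have "\<dots> = (\<integral>z. e^2 * (?D x z * B z y) + E z * L z y \<partial>M)"
      by (intro Bochner_Integration.integral_cong refl) (simp add: E_def L_def power2_eq_square algebra_simps)
    also have "\<bar>\<dots>\<bar> \<le> e^2 * (d * b) + R * e^2 * (k + b)"
    proof (rule integral_bound)
      fix z assume z: "z \<in> space M"
      have "\<bar>e^2 * (?D x z * B z y)\<bar> \<le> e^2 * (d * b)"
        unfolding abs_mult using z xy b d by (intro mult_mono) auto
      moreover have "\<bar>E z * L z y\<bar> \<le> R * e^2 * (k + b)"
        unfolding abs_mult using Eb[OF z] Lb[OF z] R0 by (intro mult_mono) auto
      ultimately show "\<bar>e^2 * (?D x z * B z y) + E z * L z y\<bar> \<le> e^2 * (d * b) + R * e^2 * (k + b)"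
        by linarith
    qed (use R0 k b d in simp)
    finally show "\<bar>kpow (\<lambda>x y. K x y + e * B x y) (Suc m) x y - kpow K (Suc m) x y - e * kpow_deriv K B (Suc m) x y\<bar>
       \<le> (d * b + R * (k + b)) * e^2"
      unfolding L_def by (simp add: algebra_simps)
  qed
qed

lemma ktrace_add_left:
  assumes "kernel K" "kernel L" "kernel N"
  shows "ktrace (\<lambda>x y. K x y + L x y) N = ktrace K N + ktrace L N"
proof -
  have k: "kernel (\<lambda>x y. K x y * N y x)" "kernel (\<lambda>x y. L x y * N y x)"
    using kernel_mult[OF assms(1) kernel_transpose[OF assms(3)]] kernel_mult[OF assms(2) kernel_transpose[OF assms(3)]] .
  have "ktrace (\<lambda>x y. K x y + L x y) N = (\<integral>x. (\<integral>y. K x y * N y x \<partial>M) + (\<integral>y. L x y * N y x \<partial>M) \<partial>M)"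
    unfolding ktrace_def
  proof (intro Bochner_Integration.integral_cong refl)
    fix x assume x: "x \<in> space M"
    show "(\<integral>y. (K x y + L x y) * N y x \<partial>M) = (\<integral>y. K x y * N y x \<partial>M) + (\<integral>y. L x y * N y x \<partial>M)"
      using kernel_integrable_right[OF k(1) x] kernel_integrable_right[OF k(2) x] by (simp add: distrib_right)
  qed
  then show ?thesis using k by (simp add: ktrace_def kernel_integrable_integral)
qed

text \<open>By cyclicity of the trace, each of the \<open>m + 1\<close> positions of
  \<open>B\<close> contributes the same. The index \<open>q\<close> is arbitrary because the
  induction moves a factor \<open>K\<close> from the derivative to the power.\<close>

lemma ktrace_kpow_deriv:
  assumes K: "kernel K" and B: "kernel B"
  shows "ktrace (kpow_deriv K B m) (kpow K q) = real (Suc m) * ktrace B (kpow K (m + q))"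
proof (induction m arbitrary: q)
  case (Suc m)
  note k = K B kernel_kpow[OF K] kernel_kpow_deriv[OF K B]
  have "ktrace (kpow_deriv K B (Suc m)) (kpow K q) = 
     ktrace (kcomp (kpow_deriv K B m) K) (kpow K q) + ktrace (kcomp (kpow K m) B) (kpow K q)"
    using k by (simp add: ktrace_add_left kernel_kcomp)
  also have "ktrace (kcomp (kpow_deriv K B m) K) (kpow K q) = ktrace (kpow_deriv K B m) (kpow K (Suc q))"
    using k kpow_add[OF K, of _ _ 0 q] by (subst ktrace_kcomp) (auto intro!: ktrace_cong)
  also have "\<dots> = real (Suc m) * ktrace B (kpow K (m + Suc q))" by (rule Suc.IH)
  also have "ktrace (kcomp (kpow K m) B) (kpow K q) = ktrace (kcomp B (kpow K q)) (kpow K m)"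
    using k by (simp add: ktrace_kcomp[of "kpow K m"] ktrace_commute[of "kpow K m"] kernel_kcomp)
  also have "\<dots> = ktrace B (kpow K (Suc (q + m)))"
    using k kpow_add[OF K, of _ _ q m] by (subst ktrace_kcomp) (auto intro!: ktrace_cong)
  finally show ?case by (simp add: algebra_simps)
qed simp

lemma cycle_integral_expansion:
  assumes K: "kernel K" and B: "kernel B"
  shows "\<exists>R\<ge>0. \<forall>e. \<bar>e\<bar> \<le> 1 \<longrightarrow> 
    \<bar>cycle_integral (\<lambda>x y. K x y + e * B x y) (Suc (Suc m)) - cycle_integral K (Suc (Suc m))
       - e * (real (Suc (Suc m)) * ktrace B (kpow K m))\<bar> \<le> R * e^2"
proof -
  obtain R where R0: "R \<ge> 0" and R: "\<And>e x y. \<bar>e\<bar> \<le> 1 \<Longrightarrow> x \<in> space M \<Longrightarrow> y \<in> space M \<Longrightarrow>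
     \<bar>kpow (\<lambda>x y. K x y + e * B x y) (Suc m) x y - kpow K (Suc m) x y - e * kpow_deriv K B (Suc m) x y\<bar> \<le> R * e^2"
    using kpow_expansion[OF K B, of "Suc m"] by blast
  have diag: "integrable M (\<lambda>x. N x x)" if N: "kernel N" for N
  proof -
    obtain b where b: "\<And>x y. x \<in> space M \<Longrightarrow> y \<in> space M \<Longrightarrow> \<bar>N x y\<bar> \<le> b" using kernel_bound[OF N] by metis
    show ?thesis using N by (intro integrable_const_bound[of _ b] AE_I2 kernel_measurable) (auto intro: b)
  qed
  \<comment> \<open>The pointwise expansion applies to the full power, hence the passage from
    \<open>ktrace\<close> to the diagonal integral.\<close>
  have ci: "cycle_integral L (Suc (Suc m)) = (\<integral>x. kpow L (Suc m) x x \<partial>M)" if "kernel L" for L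
    using that by (simp add: cycle_integral_ktrace ktrace_def kcomp_def)
  have D: "(\<integral>x. kpow_deriv K B (Suc m) x x \<partial>M) = real (Suc (Suc m)) * ktrace B (kpow K m)"
  proof -
    have "(\<integral>x. kpow_deriv K B (Suc m) x x \<partial>M) = (\<integral>x. kcomp (kpow_deriv K B m) K x x \<partial>M) + (\<integral>x. kcomp (kpow K m) B x x \<partial>M)"
      using K B by (simp add: diag kernel_kcomp kernel_kpow_deriv kernel_kpow)
    also have "\<dots> = ktrace (kpow_deriv K B m) K + ktrace (kpow K m) B"
      by (simp add: ktrace_def kcomp_def)
    also have "ktrace (kpow K m) B = ktrace B (kpow K m)" using K B by (intro ktrace_commute) auto
    also have "ktrace (kpow_deriv K B m) K = real (Suc m) * ktrace B (kpow K m)"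
      using ktrace_kpow_deriv[OF K B, of m 0] by simp
    finally show ?thesis by (simp add: algebra_simps)
  qed
  show ?thesis
  proof (intro exI[of _ R] conjI allI impI R0)
    fix e :: real assume e: "\<bar>e\<bar> \<le> 1"
    define L where "L = (\<lambda>x y. K x y + e * B x y)"
    have L: "kernel L" unfolding L_def by (intro kernel_add kernel_cmult K B)
    have "cycle_integral L (Suc (Suc m)) - cycle_integral K (Suc (Suc m)) - e * (real (Suc (Suc m)) * ktrace B (kpow K m))
      = (\<integral>x. kpow L (Suc m) x x - kpow K (Suc m) x x - e * kpow_deriv K B (Suc m) x x \<partial>M)"
      unfolding ci[OF K] ci[OF L] D[symmetric]
      using diag[OF kernel_kpow[OF K, of "Suc m"]] diag[OF kernel_kpow[OF L, of "Suc m"]] 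
        diag[OF kernel_kpow_deriv[OF K B, of "Suc m"]]
      by (simp del: kpow.simps kpow_deriv.simps)
    also have "\<bar>\<dots>\<bar> \<le> R * e^2"
      using R[OF e] R0 by (intro integral_bound) (auto simp: L_def simp del: kpow.simps kpow_deriv.simps)
    finally show "\<bar>cycle_integral (\<lambda>x y. K x y + e * B x y) (Suc (Suc m)) - cycle_integral K (Suc (Suc m))
       - e * (real (Suc (Suc m)) * ktrace B (kpow K m))\<bar> \<le> R * e^2" by (simp add: L_def)
  qed
qed

section \<open>The power of an extremal kernel is constant\<close>

lemma kernel_sq_zero_AE:
  assumes F: "kernel F" and "(\<integral>x. \<integral>y. (F x y)^2 \<partial>M \<partial>M) \<le> 0"
  shows "AE z in M \<Otimes>\<^sub>M M. F (fst z) (snd z) = 0"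
proof -
  have F2: "kernel (\<lambda>x y. (F x y)^2)" using kernel_mult[OF F F] by (simp add: power2_eq_square)
  have int: "integrable (M \<Otimes>\<^sub>M M) (\<lambda>z. (F (fst z) (snd z))^2)"
    using kernel_integrable_pair[OF F2] by (simp add: case_prod_unfold)
  have "(\<integral>z. (F (fst z) (snd z))^2 \<partial>(M \<Otimes>\<^sub>M M)) \<le> 0"
    using assms(2) by (simp add: kernel_integral_pair[OF F2])
  then have "(\<integral>z. (F (fst z) (snd z))^2 \<partial>(M \<Otimes>\<^sub>M M)) = 0"
    by (intro antisym integral_nonneg) auto
  then have "AE z in M \<Otimes>\<^sub>M M. (F (fst z) (snd z))^2 = 0"
    using int by (subst (asm) integral_nonneg_eq_0_iff_AE) auto
  then show ?thesis by simp
qed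

lemma kernel_integral_cong_AE:
  assumes "kernel F" "kernel G" "AE z in M \<Otimes>\<^sub>M M. F (fst z) (snd z) = G (fst z) (snd z)"
  shows "(\<integral>x. \<integral>y. F x y \<partial>M \<partial>M) = (\<integral>x. \<integral>y. G x y \<partial>M \<partial>M)"
  unfolding kernel_integral_pair[OF assms(1)] kernel_integral_pair[OF assms(2)]
  using assms by (intro integral_cong_AE kernel_measurable) auto

text \<open>The perturbation \<open>B\<close> is the transpose of \<open>S\<close> minus
  \<open>S\<close>. It is antisymmetric, so the sum condition survives, and the slack in
  \<open>cycle_integral_le_1\<close> admits small \<open>e > 0\<close>. The derivative is a positive
  multiple of \<open>ktrace B S\<close>, which is half the squared L2 norm of \<open>B\<close>; at a
  maximum it cannot be positive.\<close>

lemma cycle_integral_extremal_symmetric: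
  assumes K: "kernel K"
    and sym: "\<And>x y. x \<in> space M \<Longrightarrow> y \<in> space M \<Longrightarrow> K x y + K y x = 2"
    and bd: "\<And>x y. x \<in> space M \<Longrightarrow> y \<in> space M \<Longrightarrow> \<bar>K x y - 1\<bar> \<le> 1"
    and l: "Suc (Suc m) \<ge> 6" "Suc (Suc m) mod 4 = 2"
    and eq: "cycle_integral K (Suc (Suc m)) = 1"
  shows "AE z in M \<Otimes>\<^sub>M M. kpow K m (fst z) (snd z) = kpow K m (snd z) (fst z)"
proof -
  define S where "S = kpow K m"
  have S: "kernel S" using K by (auto simp: S_def)
  define B where "B x y = S y x - S x y" for x y
  have B: "kernel B" unfolding B_def by (intro kernel_diff kernel_transpose[OF S] S)
  obtain b where b: "\<And>x y. x \<in> space M \<Longrightarrow> y \<in> space M \<Longrightarrow> \<bar>B x y\<bar> \<le> b" "b \<ge> 0" using kernel_bound[OF B] by metis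
  obtain R where R: "R \<ge> 0" "\<And>e. \<bar>e\<bar> \<le> 1 \<Longrightarrow> 
    \<bar>cycle_integral (\<lambda>x y. K x y + e * B x y) (Suc (Suc m)) - cycle_integral K (Suc (Suc m))
       - e * (real (Suc (Suc m)) * ktrace B S)\<bar> \<le> R * e^2"
    using cycle_integral_expansion[OF K B, of m] unfolding S_def by blast
  define t where "t = real (Suc (Suc m)) * ktrace B S"
  \<comment> \<open>Chosen so that \<open>e * B\<close> fits into the gap of \<open>1/100\<close>;
    \<open>b + 1\<close> avoids a zero denominator.\<close>
  define e0 where "e0 = 1 / (100 * (b + 1))"
  have e0: "0 < e0" "e0 \<le> 1" "e0 * b \<le> 1/100" using b(2) by (auto simp: e0_def field_simps)
  have "t \<le> R * e" if e: "0 < e" "e \<le> e0" for e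
  proof -
    have "cycle_integral (\<lambda>x y. K x y + e * B x y) (Suc (Suc m)) \<le> 1"
    proof (rule cycle_integral_le_1[OF _ _ _ l])
      show "kernel (\<lambda>x y. K x y + e * B x y)" by (intro kernel_add kernel_cmult K B)
      fix x y assume xy: "x \<in> space M" "y \<in> space M"
      show "K x y + e * B x y + (K y x + e * B y x) = 2"
        using sym[OF xy] by (simp add: B_def algebra_simps)
      have "\<bar>e * B x y\<bar> \<le> e0 * b" unfolding abs_mult using e b xy by (intro mult_mono) auto
      then show "\<bar>K x y + e * B x y - 1\<bar> \<le> 101/100" using bd[OF xy] e0 by linarith
    qed
    then have "e * t \<le> R * e^2" using R(2)[of e] e e0 eq unfolding t_def by linarith
    then have "e * t \<le> e * (R * e)" by (simp add: power2_eq_square mult_ac)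
    then show ?thesis using e by (simp only: mult_le_cancel_left_pos)
  qed
  then have "\<forall>\<^sub>F e in at_right 0. t \<le> R * e"
    using e0(1) by (auto simp: eventually_at_right_field intro!: exI[of _ e0])
  moreover have "((\<lambda>e. R * e) \<longlongrightarrow> R * 0) (at_right 0)" by (intro tendsto_intros)
  ultimately have "t \<le> 0" by (auto intro: tendsto_lowerbound)
  then have t0: "ktrace B S \<le> 0" by (simp add: t_def mult_le_0_iff)
  have k1: "kernel (\<lambda>x y. B x y * S y x)" by (intro kernel_mult B kernel_transpose[OF S])
  have k2: "kernel (\<lambda>x y. B x y * S x y)" by (intro kernel_mult B S)
  have "ktrace B S = (\<integral>x. \<integral>y. B y x * S x y \<partial>M \<partial>M)"
    unfolding ktrace_def by (rule kernel_Fubini[OF k1])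
  also have "\<dots> = - (\<integral>x. \<integral>y. B x y * S x y \<partial>M \<partial>M)"
  proof -
    have "B y x * S x y = - (B x y * S x y)" for x y by (simp add: B_def algebra_simps)
    then show ?thesis by simp
  qed
  finally have "2 * ktrace B S = (\<integral>x. \<integral>y. B x y * S y x \<partial>M \<partial>M) - (\<integral>x. \<integral>y. B x y * S x y \<partial>M \<partial>M)"
    by (simp add: ktrace_def)
  also have "\<dots> = (\<integral>x. (\<integral>y. B x y * S y x \<partial>M) - (\<integral>y. B x y * S x y \<partial>M) \<partial>M)"
    using k1 k2 by (simp add: kernel_integrable_integral)
  also have "\<dots> = (\<integral>x. \<integral>y. (B x y)^2 \<partial>M \<partial>M)"
  proof (intro Bochner_Integration.integral_cong refl)
    fix x assume x: "x \<in> space M"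
    have "(\<integral>y. B x y * S y x \<partial>M) - (\<integral>y. B x y * S x y \<partial>M) = (\<integral>y. B x y * S y x - B x y * S x y \<partial>M)"
      using kernel_integrable_right[OF k1 x] kernel_integrable_right[OF k2 x] by simp
    then show "(\<integral>y. B x y * S y x \<partial>M) - (\<integral>y. B x y * S x y \<partial>M) = (\<integral>y. (B x y)^2 \<partial>M)"
      by (simp add: B_def power2_eq_square algebra_simps)
  qed
  finally have "(\<integral>x. \<integral>y. (B x y)^2 \<partial>M \<partial>M) \<le> 0" using t0 by simp
  from kernel_sq_zero_AE[OF B this] show ?thesis by (auto simp: B_def S_def)
qed

lemma AE_pair_commute:
  "(AE z in M \<Otimes>\<^sub>M M. Q (fst z) (snd z)) \<Longrightarrow> (AE z in M \<Otimes>\<^sub>M M. Q (snd z) (fst z))"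
proof -
  assume *: "AE z in M \<Otimes>\<^sub>M M. Q (fst z) (snd z)"
  interpret MM: pair_prob_space M M ..
  have "AE z in distr (M \<Otimes>\<^sub>M M) (M \<Otimes>\<^sub>M M) (\<lambda>(x, y). (y, x)). Q (fst z) (snd z)"
    using * by (subst MM.distr_pair_swap[symmetric])
  from AE_distrD[OF measurable_pair_swap' this] show ?thesis by (simp add: case_prod_unfold)
qed

lemma AE_pair_sections:
  assumes "AE z in M \<Otimes>\<^sub>M M. Q (fst z) (snd z)"
  shows "AE x in M. AE y in M. Q x y"
proof -
  interpret MM: pair_prob_space M M ..
  from MM.AE_pair[OF assms] show ?thesis by simp
qed

lemma AE_pair_fst: "AE x in M. Q x \<Longrightarrow> AE z in M \<Otimes>\<^sub>M M. Q (fst z)"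
proof -
  assume "AE x in M. Q x"
  then obtain N where N: "N \<in> null_sets M" "{x \<in> space M. \<not> Q x} \<subseteq> N" by (auto simp: eventually_ae_filter)
  interpret MM: pair_prob_space M M ..
  have "N \<times> space M \<in> null_sets (M \<Otimes>\<^sub>M M)"
    using N by (auto simp: null_sets_def emeasure_pair_measure_Times)
  then show ?thesis using N by (intro AE_I'[of "N \<times> space M"]) (auto simp: space_pair_measure)
qed

lemma AE_pair_snd: "AE x in M. Q x \<Longrightarrow> AE z in M \<Otimes>\<^sub>M M. Q (snd z)"
  using AE_pair_commute[of "\<lambda>x y. Q x"] AE_pair_fst by blast

lemma cycle_integral_extremal_kpow:
  assumes K: "kernel K"
    and sym: "\<And>x y. x \<in> space M \<Longrightarrow> y \<in> space M \<Longrightarrow> K x y + K y x = 2"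
    and bd: "\<And>x y. x \<in> space M \<Longrightarrow> y \<in> space M \<Longrightarrow> \<bar>K x y - 1\<bar> \<le> 1"
    and l: "Suc (Suc m) \<ge> 6" "Suc (Suc m) mod 4 = 2"
    and eq: "cycle_integral K (Suc (Suc m)) = 1"
  shows "AE z in M \<Otimes>\<^sub>M M. kpow K m (fst z) (snd z) = 1"
proof -
  define S where "S = kpow K m"
  have S: "kernel S" using K by (auto simp: S_def)
  have SS: "AE z in M \<Otimes>\<^sub>M M. S (fst z) (snd z) = S (snd z) (fst z)"
    unfolding S_def by (rule cycle_integral_extremal_symmetric[OF K sym bd l eq])
  note kt = kernel_transpose
  \<comment> \<open>\<open>S\<close> is \<open>K ^ (m + 1)\<close> with \<open>m + 1\<close> odd, so
    the length \<open>2 * m + 2\<close> is again 2 modulo 4.\<close>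
  have "ktrace S S = cycle_integral K (Suc (Suc (2 * m)))"
  proof -
    obtain p where p: "m = Suc p" using l by (cases m) auto
    have "ktrace S S = ktrace (kcomp (kpow K m) (kpow K p)) K"
      unfolding S_def using K by (simp add: p ktrace_kcomp kernel_kpow kernel_kcomp)
    also have "\<dots> = ktrace (kpow K (2 * m)) K"
      using kpow_add[OF K, of _ _ m p] by (intro ktrace_cong) (auto simp: p mult_2 simp del: kpow.simps)
    also have "\<dots> = cycle_integral K (Suc (Suc (2 * m)))" using K by (simp add: cycle_integral_ktrace)
    finally show ?thesis .
  qed
  also have "\<dots> \<le> 1"
  proof (rule cycle_integral_le_1[OF K sym])
    show "\<bar>K x y - 1\<bar> \<le> 101/100" if "x \<in> space M" "y \<in> space M" for x y using bd[OF that] by simp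
    show "Suc (Suc (2 * m)) mod 4 = 2" using l(2) by presburger
  qed (use l in auto)
  finally have tSS: "ktrace S S \<le> 1" .
  have "ktrace S S = (\<integral>x. \<integral>y. S x y * S x y \<partial>M \<partial>M)"
    unfolding ktrace_def
    by (intro kernel_integral_cong_AE kernel_mult S kt[OF S]) (use SS in auto)
  then have S2: "(\<integral>x. \<integral>y. S x y * S x y \<partial>M \<partial>M) \<le> 1" using tSS by simp
  have "ktrace S K = 1" using eq K by (simp add: cycle_integral_ktrace S_def)
  then have e1: "(\<integral>x. \<integral>y. S x y * K y x \<partial>M \<partial>M) = 1" by (simp add: ktrace_def)
  \<comment> \<open>Since \<open>S\<close> is symmetric almost everywhere, \<open>K\<close> may be
    exchanged for its transpose. Adding the two versions replaces \<open>K\<close> by the constant 2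
    and yields the integral of \<open>S\<close>.\<close>
  have "(\<integral>x. \<integral>y. S x y * K y x \<partial>M \<partial>M) = (\<integral>x. \<integral>y. S y x * K x y \<partial>M \<partial>M)"
    by (rule kernel_Fubini[OF kernel_mult[OF S kt[OF K]]])
  also have "\<dots> = (\<integral>x. \<integral>y. S x y * K x y \<partial>M \<partial>M)"
    by (intro kernel_integral_cong_AE kernel_mult S K kt[OF S]) (use SS in auto)
  finally have e2: "(\<integral>x. \<integral>y. S x y * K x y \<partial>M \<partial>M) = 1" using e1 by simp
  have iF: "integrable (M \<Otimes>\<^sub>M M) (\<lambda>z. N (fst z) (snd z))" if "kernel N" for N
    using kernel_integrable_pair[OF that] by (simp add: case_prod_unfold)
  have i1: "integrable (M \<Otimes>\<^sub>M M) (\<lambda>z. S (fst z) (snd z) * K (snd z) (fst z))" by (rule iF[OF kernel_mult[OF S kt[OF K]]])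
  have i2: "integrable (M \<Otimes>\<^sub>M M) (\<lambda>z. S (fst z) (snd z) * K (fst z) (snd z))" by (rule iF[OF kernel_mult[OF S K]])
  have i3: "integrable (M \<Otimes>\<^sub>M M) (\<lambda>z. S (fst z) (snd z) * S (fst z) (snd z))" by (rule iF[OF kernel_mult[OF S S]])
  have i4: "integrable (M \<Otimes>\<^sub>M M) (\<lambda>z. S (fst z) (snd z))" by (rule iF[OF S])
  interpret MM: pair_prob_space M M ..
  have "2 = (\<integral>z. S (fst z) (snd z) * K (snd z) (fst z) + S (fst z) (snd z) * K (fst z) (snd z) \<partial>(M \<Otimes>\<^sub>M M))"
    using e1 e2 i1 i2
    by (simp add: kernel_integral_pair[OF kernel_mult[OF S kt[OF K]]] kernel_integral_pair[OF kernel_mult[OF S K]])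
  also have "\<dots> = (\<integral>z. S (fst z) (snd z) * 2 \<partial>(M \<Otimes>\<^sub>M M))"
    using sym by (intro Bochner_Integration.integral_cong refl)
      (auto simp: space_pair_measure distrib_left[symmetric] add.commute)
  finally have S1: "(\<integral>z. S (fst z) (snd z) \<partial>(M \<Otimes>\<^sub>M M)) = 1" by simp
  have kd: "kernel (\<lambda>x y. S x y - 1)" by (intro kernel_diff S kernel_const)
  have "(\<integral>x. \<integral>y. (S x y - 1)^2 \<partial>M \<partial>M) = (\<integral>z. (S (fst z) (snd z) - 1)^2 \<partial>(M \<Otimes>\<^sub>M M))"
    using kernel_mult[OF kd kd] by (subst kernel_integral_pair) (auto simp: power2_eq_square)
  also have "\<dots> = (\<integral>z. S (fst z) (snd z) * S (fst z) (snd z) - 2 * S (fst z) (snd z) + 1 \<partial>(M \<Otimes>\<^sub>M M))"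
    by (intro Bochner_Integration.integral_cong refl) (simp add: power2_eq_square algebra_simps)
  also have "\<dots> = (\<integral>z. S (fst z) (snd z) * S (fst z) (snd z) \<partial>(M \<Otimes>\<^sub>M M)) - 2 + 1"
    using i3 i4 S1 MM.prob_space by simp
  also have "\<dots> \<le> 0" using S2 by (simp add: kernel_integral_pair[OF kernel_mult[OF S S]])
  finally have "AE z in M \<Otimes>\<^sub>M M. S (fst z) (snd z) - 1 = 0" by (rule kernel_sq_zero_AE[OF kd])
  then show ?thesis by (simp add: S_def)
qed

section \<open>From the constant power back to the kernel\<close>

lemma kcomp_AE_zero_right:
  assumes G: "AE z in M \<Otimes>\<^sub>M M. G (fst z) (snd z) = 0"
  shows "AE z in M \<Otimes>\<^sub>M M. kcomp K G (fst z) (snd z) = 0"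
proof -
  have "AE y in M. AE x in M. G x y = 0"
    using AE_pair_sections[OF AE_pair_commute[OF G]] .
  then have "AE z in M \<Otimes>\<^sub>M M. AE x in M. G x (snd z) = 0" by (rule AE_pair_snd)
  then show ?thesis
    unfolding kcomp_def by eventually_elim (auto intro!: integral_eq_zero_AE)
qed

lemma kcomp_AE_zero_left:
  assumes G: "AE z in M \<Otimes>\<^sub>M M. G (fst z) (snd z) = 0"
  shows "AE z in M \<Otimes>\<^sub>M M. kcomp G K (fst z) (snd z) = 0"
proof -
  from AE_pair_fst[OF AE_pair_sections[OF G]] show ?thesis
    unfolding kcomp_def by eventually_elim (auto intro!: integral_eq_zero_AE)
qed

lemma kcomp_add_left:
  assumes "kernel K" "kernel L" "kernel N" "x \<in> space M" "y \<in> space M"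
  shows "kcomp (\<lambda>x y. K x y + L x y) N x y = kcomp K N x y + kcomp L N x y"
  unfolding kcomp_def using assms kernel_mult_section[of K N x y] kernel_mult_section[of L N x y]
  by (simp add: distrib_right)

lemma kcomp_add_right:
  assumes "kernel K" "kernel L" "kernel N" "x \<in> space M" "y \<in> space M"
  shows "kcomp N (\<lambda>x y. K x y + L x y) x y = kcomp N K x y + kcomp N L x y"
  unfolding kcomp_def using assms kernel_mult_section[of N K x y] kernel_mult_section[of N L x y]
  by (simp add: distrib_left)

text \<open>Composition with \<open>A\<close> is skew-adjoint for the L2 inner product of kernels.
  The inner product is a \<open>ktrace\<close> against the transpose \<open>T\<close>, so cyclicity
  of the trace moves \<open>A\<close> across.\<close>

lemma antisymmetric_adjoint:
  assumes A: "kernel A" and anti: "\<And>x y. x \<in> space M \<Longrightarrow> y \<in> space M \<Longrightarrow> A y x = - A x y"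
    and V: "kernel V" and H: "kernel H"
  shows "(\<integral>x. \<integral>y. kcomp A V x y * H x y \<partial>M \<partial>M) = - (\<integral>x. \<integral>y. V x y * kcomp A H x y \<partial>M \<partial>M)"
proof -
  define T where "T x y = H y x" for x y
  have T: "kernel T" unfolding T_def by (rule kernel_transpose[OF H])
  have "(\<integral>x. \<integral>y. kcomp A V x y * H x y \<partial>M \<partial>M) = ktrace (kcomp A V) T"
    by (simp add: ktrace_def T_def)
  also have "\<dots> = ktrace T (kcomp A V)" by (intro ktrace_commute T kernel_kcomp A V)
  also have "\<dots> = ktrace (kcomp T A) V" by (intro ktrace_kcomp[symmetric] T A V)
  also have "\<dots> = ktrace V (kcomp T A)" by (intro ktrace_commute T kernel_kcomp A V)
  also have "\<dots> = (\<integral>x. \<integral>y. - (V x y * kcomp A H x y) \<partial>M \<partial>M)"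
    unfolding ktrace_def
  proof (intro Bochner_Integration.integral_cong refl)
    fix x y assume xy: "x \<in> space M" "y \<in> space M"
    have "kcomp T A y x = (\<integral>z. - (A x z * H z y) \<partial>M)"
      unfolding kcomp_def T_def
    proof (intro Bochner_Integration.integral_cong refl)
      fix z assume "z \<in> space M"
      then show "H z y * A z x = - (A x z * H z y)" by (simp add: anti[OF xy(1)])
    qed
    then show "V x y * kcomp T A y x = - (V x y * kcomp A H x y)" by (simp add: kcomp_def)
  qed
  finally show ?thesis by simp
qed

text \<open>Descent on the exponent, with \<open>G\<close> as the vector acted upon: if
  \<open>H = A V\<close> and \<open>A H = 0\<close>, then the squared norm of \<open>H\<close> is
  minus the inner product of \<open>V\<close> and \<open>A H\<close>, hence 0.\<close>

lemma antisymmetric_nilpotent: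
  assumes A: "kernel A" and anti: "\<And>x y. x \<in> space M \<Longrightarrow> y \<in> space M \<Longrightarrow> A y x = - A x y"
    and nil: "AE z in M \<Otimes>\<^sub>M M. kpow A m (fst z) (snd z) = 0" and G: "kernel G"
  shows "AE z in M \<Otimes>\<^sub>M M. kcomp A G (fst z) (snd z) = 0"
proof -
  have "\<forall>G. kernel G \<longrightarrow> (AE z in M \<Otimes>\<^sub>M M. kcomp (kpow A j) G (fst z) (snd z) = 0)" if "j \<le> m" for j
    using that
  proof (induction j rule: inc_induct)
    case base
    show ?case using kcomp_AE_zero_left[OF nil] by blast
  next
    case (step j)
    show ?case
    proof (intro allI impI)
      fix G assume G: "kernel G"
      define H where "H = kcomp (kpow A j) G"
      have H: "kernel H" unfolding H_def by (intro kernel_kcomp kernel_kpow A G)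
      \<comment> \<open>\<open>H\<close> stands for \<open>A ^ (j + 1)\<close> applied to
        \<open>G\<close>, so \<open>V\<close> is \<open>A ^ j\<close> applied to \<open>G\<close>.
        For \<open>j = 0\<close> this is \<open>G\<close> itself, which the shifted
        \<open>kpow\<close> cannot express.\<close>
      obtain V where V: "kernel V" and HV: "\<And>x y. x \<in> space M \<Longrightarrow> y \<in> space M \<Longrightarrow> H x y = kcomp A V x y"
      proof (cases j)
        case 0
        then show ?thesis by (intro that[OF G]) (simp add: H_def)
      next
        case (Suc i)
        let ?V = "kcomp (kpow A i) G"
        have "H x y = kcomp A ?V x y" if "x \<in> space M" "y \<in> space M" for x y
        proof -
          have "H x y = kcomp (kcomp (kpow A 0) (kpow A i)) G x y"
            unfolding H_def using kpow_add[OF A, of _ _ 0 i] that 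
            by (intro kcomp_cong[OF _ refl]) (auto simp: Suc simp del: kpow.simps)
          then show ?thesis using A G that by (simp add: kcomp_assoc kernel_kpow)
        qed
        moreover have "kernel ?V" by (intro kernel_kcomp kernel_kpow A G)
        ultimately show ?thesis by (intro that)
      qed
      have AH: "kcomp A H x y = kcomp (kpow A (Suc j)) G x y" if "x \<in> space M" "y \<in> space M" for x y
      proof -
        have "kcomp (kpow A (Suc j)) G x y = kcomp (kcomp (kpow A 0) (kpow A j)) G x y"
          using kpow_add[OF A, of _ _ 0 j] that by (intro kcomp_cong[OF _ refl]) (auto simp del: kpow.simps)
        then show ?thesis using A G that by (simp add: kcomp_assoc kernel_kpow H_def)
      qed
      have "AE z in M \<Otimes>\<^sub>M M. kcomp (kpow A (Suc j)) G (fst z) (snd z) = 0" using step.IH G by blast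
      then have AH0: "AE z in M \<Otimes>\<^sub>M M. kcomp A H (fst z) (snd z) = 0"
        using AE_space by eventually_elim (auto simp: AH space_pair_measure simp del: kpow.simps)
      have "(\<integral>x. \<integral>y. (H x y)^2 \<partial>M \<partial>M) = (\<integral>x. \<integral>y. kcomp A V x y * H x y \<partial>M \<partial>M)"
        using HV by (intro Bochner_Integration.integral_cong refl) (simp add: power2_eq_square)
      also have "\<dots> = - (\<integral>x. \<integral>y. V x y * kcomp A H x y \<partial>M \<partial>M)"
        by (rule antisymmetric_adjoint[OF A anti V H])
      also have "(\<integral>x. \<integral>y. V x y * kcomp A H x y \<partial>M \<partial>M) = (\<integral>x. \<integral>y. 0 \<partial>M \<partial>M)"
        by (intro kernel_integral_cong_AE kernel_mult V kernel_kcomp A H kernel_const) (use AH0 in auto)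
      finally have "(\<integral>x. \<integral>y. (H x y)^2 \<partial>M \<partial>M) \<le> 0" by simp
      from kernel_sq_zero_AE[OF H this] show "AE z in M \<Otimes>\<^sub>M M. kcomp (kpow A j) G (fst z) (snd z) = 0"
        by (simp add: H_def)
    qed
  qed
  from this[of 0] G show ?thesis by simp
qed

text \<open>\<open>K\<close> commutes with its power \<open>S\<close>, which integrates against 1.
  Applied to the constant 1, \<open>S K\<close> gives the total integral of \<open>K\<close>, which
  is 1 by \<open>sym\<close>, while \<open>K S\<close> gives the row integral of
  \<open>K\<close>.\<close>

lemma kernel_marginal_extremal:
  assumes K: "kernel K"
    and sym: "\<And>x y. x \<in> space M \<Longrightarrow> y \<in> space M \<Longrightarrow> K x y + K y x = 2"
    and S1: "AE z in M \<Otimes>\<^sub>M M. kpow K m (fst z) (snd z) = 1"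
  shows "AE x in M. (\<integral>y. K x y \<partial>M) = 1"
proof -
  define S where "S = kpow K m"
  \<comment> \<open>A function of one variable is represented by a kernel that is constant in the
    second; the argument \<open>w\<close> below is thus arbitrary.\<close>
  define J :: "'a \<Rightarrow> 'a \<Rightarrow> real" where "J = (\<lambda>x y. 1)"
  have J: "kernel J" unfolding J_def by (rule kernel_const)
  have S: "kernel S" using K by (auto simp: S_def)
  have Sx: "AE x in M. AE y in M. S x y = 1" using AE_pair_sections[OF S1] by (simp add: S_def)
  have KJ: "kcomp K J x y = (\<integral>z. K x z \<partial>M)" for x y by (simp add: kcomp_def J_def)
  have KJ1: "(\<integral>x. \<integral>y. K x y \<partial>M \<partial>M) = 1"
  proof -
    have "(\<integral>x. \<integral>y. K x y \<partial>M \<partial>M) = (\<integral>x. \<integral>y. K y x \<partial>M \<partial>M)" by (rule kernel_Fubini[OF K])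
    also have "\<dots> = (\<integral>x. 2 - (\<integral>y. K x y \<partial>M) \<partial>M)"
    proof (intro Bochner_Integration.integral_cong refl)
      fix x assume x: "x \<in> space M"
      have "(\<integral>y. K y x \<partial>M) = (\<integral>y. 2 - K x y \<partial>M)"
        using sym x by (intro Bochner_Integration.integral_cong refl) (simp add: algebra_simps)
      then show "(\<integral>y. K y x \<partial>M) = 2 - (\<integral>y. K x y \<partial>M)"
        using kernel_integrable_right[OF K x] by (simp add: prob_space)
    qed
    also have "\<dots> = 2 - (\<integral>x. \<integral>y. K x y \<partial>M \<partial>M)"
      using kernel_integrable_integral[OF K] by (simp add: prob_space)
    finally show ?thesis by simp
  qed
  have SJ: "AE x in M. kcomp S J x w = 1" for w
    using Sx AE_space
  proof eventually_elim
    case (elim x)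
    have "kcomp S J x w = (\<integral>y. S x y \<partial>M)" by (simp add: kcomp_def J_def)
    also have "\<dots> = (\<integral>y. 1 \<partial>M)"
      using elim S by (intro integral_cong_AE) (auto intro!: borel_measurable_integrable kernel_integrable_right)
    finally show ?case by (simp add: prob_space)
  qed
  obtain w where w: "w \<in> space M" using not_empty by blast
  have "AE x in M. kcomp S (kcomp K J) x w = 1"
    using Sx AE_space
  proof eventually_elim
    case (elim x)
    have "kcomp S (kcomp K J) x w = (\<integral>z. 1 * (\<integral>y. K z y \<partial>M) \<partial>M)"
      unfolding kcomp_def[of S] KJ
      using borel_measurable_integrable[OF kernel_integrable_right[OF S elim(2)]]
        kernel_integral_measurable[OF K] elim(1)
      by (intro integral_cong_AE) auto
    then show ?case using KJ1 by simp
  qed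
  moreover have "kcomp S (kcomp K J) x w = (\<integral>z. K x z \<partial>M)" if x: "x \<in> space M" for x
  proof -
    have "kcomp S (kcomp K J) x w = kcomp (kcomp S K) J x w"
      using S K J x w by (simp add: kcomp_assoc)
    also have "\<dots> = kcomp (kcomp K S) J x w"
      by (rule kcomp_cong) (use kpow_add[OF K, of _ _ 0 m] x w in \<open>auto simp: S_def\<close>)
    also have "\<dots> = kcomp K (kcomp S J) x w" using S K J x w by (simp add: kcomp_assoc)
    also have "\<dots> = (\<integral>z. K x z * 1 \<partial>M)"
      unfolding kcomp_def[of K]
      using borel_measurable_integrable[OF kernel_integrable_right[OF K x]]
        borel_measurable_integrable[OF kernel_integrable_left[OF kernel_kcomp[OF S J] w]] SJ[of w]
      by (intro integral_cong_AE) auto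
    finally show ?thesis by simp
  qed
  ultimately have "AE x in M. x \<in> space M \<longrightarrow> (\<integral>z. K x z \<partial>M) = 1"
    by (auto elim: eventually_mono)
  with AE_space show ?thesis by eventually_elim simp
qed

text \<open>Write \<open>K = J + A\<close>. The marginals make \<open>A J\<close> and
  \<open>J A\<close> vanish almost everywhere, and \<open>J J = J\<close>, so no mixed terms survive
  in a power.\<close>

lemma kpow_minus_one:
  assumes K: "kernel K"
    and sym: "\<And>x y. x \<in> space M \<Longrightarrow> y \<in> space M \<Longrightarrow> K x y + K y x = 2"
    and marg: "AE x in M. (\<integral>y. K x y \<partial>M) = 1"
  shows "AE z in M \<Otimes>\<^sub>M M. kpow (\<lambda>x y. K x y - 1) m (fst z) (snd z) = kpow K m (fst z) (snd z) - 1"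
proof -
  define A where "A x y = K x y - 1" for x y
  define J :: "'a \<Rightarrow> 'a \<Rightarrow> real" where "J = (\<lambda>x y. 1)"
  have J: "kernel J" unfolding J_def by (rule kernel_const)
  have A: "kernel A" unfolding A_def by (intro kernel_diff K kernel_const)
  have "AE x in M. (\<integral>y. A x y \<partial>M) = 0"
    using marg AE_space by eventually_elim (auto simp: A_def prob_space kernel_integrable_right[OF K])
  then have AJ: "AE z in M \<Otimes>\<^sub>M M. kcomp A J (fst z) (snd z) = 0"
    using AE_pair_fst[of "\<lambda>x. (\<integral>y. A x y \<partial>M) = 0"] by (simp add: kcomp_def J_def)
  have "AE x in M. (\<integral>y. A y x \<partial>M) = 0"
    using marg AE_space
  proof eventually_elim
    case (elim x)
    have "(\<integral>y. A y x \<partial>M) = (\<integral>y. 1 - K x y \<partial>M)"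
      using sym elim by (intro Bochner_Integration.integral_cong refl) (simp add: A_def algebra_simps)
    then show ?case using elim by (simp add: prob_space kernel_integrable_right[OF K])
  qed
  then have JA: "AE z in M \<Otimes>\<^sub>M M. kcomp J A (fst z) (snd z) = 0"
    using AE_pair_snd[of "\<lambda>x. (\<integral>y. A y x \<partial>M) = 0"] by (simp add: kcomp_def J_def)
  have "AE z in M \<Otimes>\<^sub>M M. kpow K m (fst z) (snd z) = 1 + kpow A m (fst z) (snd z)"
  proof (induction m)
    case 0 show ?case by (simp add: A_def)
  next
    case (Suc m)
    have PJ: "AE z in M \<Otimes>\<^sub>M M. kcomp (kpow A m) J (fst z) (snd z) = 0"
    proof (cases m)
      case 0 then show ?thesis using AJ by simp
    next
      case (Suc i)
      have "AE z in M \<Otimes>\<^sub>M M. kcomp (kpow A i) (kcomp A J) (fst z) (snd z) = 0"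
        by (rule kcomp_AE_zero_right[OF AJ])
      then show ?thesis using AE_space
        by eventually_elim (auto simp: Suc space_pair_measure kcomp_assoc A J kernel_kpow)
    qed
    \<comment> \<open>The induction hypothesis holds only almost everywhere; \<open>D\<close>
      collects the error, and composing a null kernel with \<open>K\<close> keeps it null.\<close>
    define D where "D = (\<lambda>x y. kpow K m x y - (J x y + kpow A m x y))"
    have Q: "kernel (\<lambda>x y. J x y + kpow A m x y)" by (intro kernel_add J kernel_kpow A)
    have D: "kernel D" unfolding D_def by (intro kernel_diff kernel_kpow K Q)
    have "AE z in M \<Otimes>\<^sub>M M. D (fst z) (snd z) = 0" using Suc by (simp add: D_def J_def)
    then have "AE z in M \<Otimes>\<^sub>M M. kcomp D K (fst z) (snd z) = 0" by (rule kcomp_AE_zero_left)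
    then show ?case using PJ JA AE_space
    proof eventually_elim
      case (elim z)
      obtain x y where z: "z = (x, y)" by force
      have xy: "x \<in> space M" "y \<in> space M" using elim z by (auto simp: space_pair_measure)
      have "kpow K (Suc m) x y = kcomp (\<lambda>x y. D x y + (J x y + kpow A m x y)) K x y"
        by (simp add: D_def)
      also have "\<dots> = kcomp D K x y + kcomp (\<lambda>x y. J x y + kpow A m x y) K x y"
        by (intro kcomp_add_left D Q K xy)
      also have "kcomp (\<lambda>x y. J x y + kpow A m x y) K x y = kcomp J K x y + kcomp (kpow A m) K x y"
        by (intro kcomp_add_left J kernel_kpow A K xy)
      finally have "kpow K (Suc m) x y = kcomp D K x y + (kcomp J K x y + kcomp (kpow A m) K x y)" .
      moreover have "kcomp N K x y = kcomp N J x y + kcomp N A x y" if "kernel N" for N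
        using kcomp_add_right[OF J A that xy] by (simp add: A_def J_def)
      note this[OF J] this[OF kernel_kpow[OF A, of m]]
      moreover have "kcomp J J x y = 1" by (simp add: kcomp_def J_def prob_space)
      ultimately show ?case using elim by (simp add: z)
    qed
  qed
  then show ?thesis unfolding A_def by eventually_elim simp
qed

text \<open>Integrating \<open>kcomp (K - 1) G = 0\<close> for indicators \<open>G\<close> shows that the measure with density \<open>K\<close>
  agrees with the product measure on rectangles.\<close>

lemma kernel_eq_one_AE:
  assumes K: "kernel K" and nn: "\<And>x y. x \<in> space M \<Longrightarrow> y \<in> space M \<Longrightarrow> 0 \<le> K x y"
    and zero: "\<And>G. kernel G \<Longrightarrow> AE z in M \<Otimes>\<^sub>M M. kcomp (\<lambda>x y. K x y - 1) G (fst z) (snd z) = 0"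
  shows "AE z in M \<Otimes>\<^sub>M M. K (fst z) (snd z) = 1"
proof -
  interpret MM: pair_prob_space M M ..
  have Kz: "(\<lambda>z. K (fst z) (snd z)) \<in> borel_measurable (M \<Otimes>\<^sub>M M)" using K by (intro kernel_measurable) auto
  let ?D = "density (M \<Otimes>\<^sub>M M) (\<lambda>z. ennreal (K (fst z) (snd z)))"
  have "M \<Otimes>\<^sub>M M = ?D"
  proof (rule pair_measure_eqI)
    show "sigma_finite_measure M" "sigma_finite_measure M" by unfold_locales
    show "sets (M \<Otimes>\<^sub>M M) = sets ?D" by simp
    fix E F assume EF: "E \<in> sets M" "F \<in> sets M"
    define G :: "'a \<Rightarrow> 'a \<Rightarrow> real" where "G x y = indicator F x" for x y
    have G: "kernel G" unfolding G_def using EF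
      by (intro kernelI[of _ 1]) (auto simp: case_prod_unfold split: split_indicator)
    define I :: "'a \<Rightarrow> 'a \<Rightarrow> real" where "I x y = indicator E x * indicator F y" for x y
    have I: "kernel I" unfolding I_def using EF
      by (intro kernelI[of _ 1]) (auto simp: case_prod_unfold split: split_indicator)
    have KI: "kernel (\<lambda>x y. K x y * I x y)" by (intro kernel_mult K I)
    have "AE x in M. AE y in M. kcomp (\<lambda>x y. K x y - 1) G x y = 0" using AE_pair_sections[OF zero[OF G]] .
    then have ae: "AE x in M. (\<integral>y. K x y * indicator F y \<partial>M) = measure M F"
      using AE_space
    proof eventually_elim
      case (elim x)
      \<comment> \<open>\<open>G\<close> ignores its second argument, so the value is the same for
        all \<open>y\<close> and a single \<open>y\<close> suffices.\<close>
      have "\<exists>y. kcomp (\<lambda>x y. K x y - 1) G x y = 0"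
        by (rule eventually_happens'[OF ae_filter_bot elim(1)])
      then have "(\<integral>y. (K x y - 1) * indicator F y \<partial>M) = 0" by (auto simp: kcomp_def G_def)
      moreover have "integrable M (\<lambda>y. K x y * indicator F y)"
        using kernel_mult_section[OF K G elim(2) elim(2)] by (simp add: G_def)
      moreover have "integrable M (indicat_real F)"
        using EF by (intro integrable_real_indicator) (simp_all add: emeasure_eq_measure)
      ultimately show ?case using EF by (simp add: left_diff_distrib)
    qed
    have "(\<integral>z. K (fst z) (snd z) * I (fst z) (snd z) \<partial>(M \<Otimes>\<^sub>M M)) = (\<integral>x. \<integral>y. K x y * I x y \<partial>M \<partial>M)"
      by (rule kernel_integral_pair[OF KI, symmetric])
    also have "\<dots> = (\<integral>x. indicator E x * measure M F \<partial>M)"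
    proof (rule integral_cong_AE)
      show "AE x in M. (\<integral>y. K x y * I x y \<partial>M) = indicator E x * measure M F"
        using ae by eventually_elim (auto simp: I_def mult_ac split: split_indicator)
    qed (use EF kernel_integral_measurable[OF KI] in auto)
    also have "\<dots> = measure M E * measure M F" using EF by simp
    finally have int: "(\<integral>z. K (fst z) (snd z) * I (fst z) (snd z) \<partial>(M \<Otimes>\<^sub>M M)) = measure M E * measure M F" .
    have "emeasure ?D (E \<times> F) = (\<integral>\<^sup>+z. ennreal (K (fst z) (snd z)) * indicator (E \<times> F) z \<partial>(M \<Otimes>\<^sub>M M))"
      using EF Kz by (simp add: emeasure_density)
    also have "\<dots> = (\<integral>\<^sup>+z. ennreal (K (fst z) (snd z) * I (fst z) (snd z)) \<partial>(M \<Otimes>\<^sub>M M))"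
      by (intro nn_integral_cong) (auto simp: I_def split: split_indicator)
    also have "\<dots> = ennreal (\<integral>z. K (fst z) (snd z) * I (fst z) (snd z) \<partial>(M \<Otimes>\<^sub>M M))"
      using kernel_integrable_pair[OF KI] nn
      by (intro nn_integral_eq_integral AE_I2) (auto simp: case_prod_unfold I_def space_pair_measure)
    also have "\<dots> = emeasure M E * emeasure M F"
      by (simp add: int emeasure_eq_measure ennreal_mult)
    finally show "emeasure M E * emeasure M F = emeasure ?D (E \<times> F)" by simp
  qed
  then have "density (M \<Otimes>\<^sub>M M) (\<lambda>z. 1) = ?D" by (simp only: density_1)
  then have "AE z in M \<Otimes>\<^sub>M M. 1 = ennreal (K (fst z) (snd z))"
    by (rule MM.density_unique[rotated 2]) (use Kz in simp_all)
  then show ?thesis by eventually_elim (metis ennreal_eq_1)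
qed

lemma cycle_integral_eq_1_imp:
  assumes K: "kernel K"
    and sym: "\<And>x y. x \<in> space M \<Longrightarrow> y \<in> space M \<Longrightarrow> K x y + K y x = 2"
    and bd: "\<And>x y. x \<in> space M \<Longrightarrow> y \<in> space M \<Longrightarrow> \<bar>K x y - 1\<bar> \<le> 1"
    and l: "l \<ge> 6" "l mod 4 = 2"
    and eq: "cycle_integral K l = 1"
  shows "AE z in M \<Otimes>\<^sub>M M. K (fst z) (snd z) = 1"
proof -
  define m where "m = l - 2"
  have m: "l = Suc (Suc m)" using l(1) by (simp add: m_def)
  have S: "AE z in M \<Otimes>\<^sub>M M. kpow K m (fst z) (snd z) = 1"
    using l eq unfolding m by (intro cycle_integral_extremal_kpow[OF K sym bd])
  have "AE z in M \<Otimes>\<^sub>M M. kpow (\<lambda>x y. K x y - 1) m (fst z) (snd z) = 0"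
  proof -
    have marg: "AE x in M. (\<integral>y. K x y \<partial>M) = 1" by (rule kernel_marginal_extremal[OF K sym S])
    have "AE z in M \<Otimes>\<^sub>M M. kpow (\<lambda>x y. K x y - 1) m (fst z) (snd z) = kpow K m (fst z) (snd z) - 1"
      by (rule kpow_minus_one[OF K sym marg])
    then show ?thesis using S by eventually_elim simp
  qed
  then have *: "AE z in M \<Otimes>\<^sub>M M. kcomp (\<lambda>x y. K x y - 1) G (fst z) (snd z) = 0" if "kernel G" for G
  proof (rule antisymmetric_nilpotent[rotated 2])
    show "kernel (\<lambda>x y. K x y - 1)" by (intro kernel_diff K kernel_const)
    show "K y x - 1 = - (K x y - 1)" if "x \<in> space M" "y \<in> space M" for x y using sym[OF that] by simp
  qed (rule that)
  show ?thesis
  proof (rule kernel_eq_one_AE[OF K _ *])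
    show "0 \<le> K x y" if "x \<in> space M" "y \<in> space M" for x y using bd[OF that] by linarith
  qed
qed

section \<open>Two coordinates of a product space\<close>

lemma distr_PiM_pair:
  assumes "finite I" "i \<in> I" "j \<in> I" "i \<noteq> j"
  shows "distr (\<Pi>\<^sub>M k\<in>I. M) (M \<Otimes>\<^sub>M M) (\<lambda>x. (x i, x j)) = M \<Otimes>\<^sub>M M"
proof (rule pair_measure_eqI[symmetric])
  show "sigma_finite_measure M" "sigma_finite_measure M" by unfold_locales
  show "sets (M \<Otimes>\<^sub>M M) = sets (distr (\<Pi>\<^sub>M k\<in>I. M) (M \<Otimes>\<^sub>M M) (\<lambda>x. (x i, x j)))" by simp
  interpret P: product_prob_space "\<lambda>_. M" I ..
  fix A B assume AB: "A \<in> sets M" "B \<in> sets M"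
  define X where "X k = (if k = i then A else B)" for k
  have "emeasure (distr (\<Pi>\<^sub>M k\<in>I. M) (M \<Otimes>\<^sub>M M) (\<lambda>x. (x i, x j))) (A \<times> B)
    = emeasure (\<Pi>\<^sub>M k\<in>I. M) ((\<lambda>x. (x i, x j)) -` (A \<times> B) \<inter> space (\<Pi>\<^sub>M k\<in>I. M))"
    using assms AB by (intro emeasure_distr) auto
  also have "(\<lambda>x. (x i, x j)) -` (A \<times> B) \<inter> space (\<Pi>\<^sub>M k\<in>I. M) = prod_emb I (\<lambda>_. M) {i, j} (Pi\<^sub>E {i, j} X)"
    using assms by (auto simp: prod_emb_def X_def space_PiM PiE_iff)
  also have "emeasure (\<Pi>\<^sub>M k\<in>I. M) \<dots> = (\<Prod>k\<in>{i, j}. emeasure M (X k))"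
    using assms AB by (intro P.emeasure_PiM_emb) (auto simp: X_def)
  also have "\<dots> = emeasure M A * emeasure M B" using assms by (simp add: X_def)
  finally show "emeasure M A * emeasure M B = emeasure (distr (\<Pi>\<^sub>M k\<in>I. M) (M \<Otimes>\<^sub>M M) (\<lambda>x. (x i, x j))) (A \<times> B)"
    by simp
qed

text \<open>Transfers an almost everywhere statement on the square to one arc of a cycle. The
  condition \<open>i \<noteq> j\<close> is essential, as nothing is known on the diagonal, which may
  be a null set.\<close>

lemma AE_PiM_pair:
  assumes "finite I" "i \<in> I" "j \<in> I" "i \<noteq> j" and "AE z in M \<Otimes>\<^sub>M M. Q (fst z) (snd z)"
  shows "AE x in (\<Pi>\<^sub>M k\<in>I. M). Q (x i) (x j)"
proof -
  have "AE z in distr (\<Pi>\<^sub>M k\<in>I. M) (M \<Otimes>\<^sub>M M) (\<lambda>x. (x i, x j)). Q (fst z) (snd z)"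
    unfolding distr_PiM_pair[OF assms(1-4)] by (rule assms(5))
  from AE_distrD[OF _ this] show ?thesis using assms by simp
qed

end

section \<open>Tournamentons\<close>

text \<open>Gives measurability of the cycle product of \<open>W\<close>, which only agrees almost
  everywhere with one built from a Borel kernel.\<close>

lemma (in complete_measure) measurable_AE_cong:
  assumes f: "f \<in> M \<rightarrow>\<^sub>M N" and ae: "AE x in M. f x = g x" and g: "g \<in> space M \<rightarrow> space N"
  shows "g \<in> M \<rightarrow>\<^sub>M N"
proof (rule measurableI)
  fix A assume A: "A \<in> sets N"
  show "g -` A \<inter> space M \<in> sets M"
  proof (rule in_sets_AE)
    show "f -` A \<inter> space M \<in> sets M" using f A by (rule measurable_sets)
    show "AE x in M. (x \<in> f -` A \<inter> space M) = (x \<in> g -` A \<inter> space M)"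
      using ae by eventually_elim auto
  qed auto
qed (use g in auto)

abbreviation unit_interval :: "real measure" where
  "unit_interval \<equiv> restrict_space lborel {0..1}"

interpretation U: prob_space unit_interval
  by (rule prob_spaceI) (simp add: emeasure_restrict_space space_restrict_space)

lemma space_unit_interval [simp]: "space unit_interval = {0..1}"
  by (simp add: space_restrict_space)

lemma unit_square_measure:
  "unit_interval \<Otimes>\<^sub>M unit_interval = restrict_space lborel ({0..1} \<times> {0..1})" (is "?UU = ?R")
proof (rule pair_measure_eqI)
  show "sigma_finite_measure unit_interval" "sigma_finite_measure unit_interval" by unfold_locales
  have S: "({0..1} \<times> {0..1} :: (real \<times> real) set) \<in> sets borel" by (intro borel_closed closed_Times) auto
  have sp: "space ?UU = {0..1} \<times> {0..1}" "space ?R = {0..1} \<times> {0..1}"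
    by (auto simp: space_pair_measure space_restrict_space)
  have m: "(\<lambda>x. x) \<in> unit_interval \<rightarrow>\<^sub>M borel" by (intro measurable_restrict_space1) simp
  have "(\<lambda>z. (fst z, snd z)) \<in> ?UU \<rightarrow>\<^sub>M borel \<Otimes>\<^sub>M borel"
    using measurable_compose[OF measurable_fst m] measurable_compose[OF measurable_snd m] by (intro measurable_Pair)
  then have 1: "(\<lambda>z. z) \<in> ?UU \<rightarrow>\<^sub>M ?R"
    using sp by (intro measurable_restrict_space2) (auto simp: borel_prod)
  have f: "fst \<in> ?R \<rightarrow>\<^sub>M unit_interval" and s: "snd \<in> ?R \<rightarrow>\<^sub>M unit_interval"
    by (intro measurable_restrict_space2 measurable_restrict_space1; auto simp: space_restrict_space borel_prod[symmetric])+
  have 2: "(\<lambda>z. z) \<in> ?R \<rightarrow>\<^sub>M ?UU" using measurable_Pair[OF f s] by simp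
  \<comment> \<open>The identity is measurable in both directions, by \<open>1\<close> and
    \<open>2\<close>.\<close>
  show "sets ?UU = sets ?R"
  proof (intro subset_antisym subsetI)
    fix A assume A: "A \<in> sets ?UU"
    then have "A \<subseteq> {0..1} \<times> {0..1}" using sets.sets_into_space[OF A] sp by simp
    then show "A \<in> sets ?R" using measurable_sets[OF 2 A] sp by (simp add: Int_absorb2)
  next
    fix A assume A: "A \<in> sets ?R"
    then have "A \<subseteq> {0..1} \<times> {0..1}" using sets.sets_into_space[OF A] sp by simp
    then show "A \<in> sets ?UU" using measurable_sets[OF 1 A] sp by (simp add: Int_absorb2)
  qed
  fix A B assume "A \<in> sets unit_interval" "B \<in> sets unit_interval"
  then have AB: "A \<in> sets borel" "B \<in> sets borel" "A \<subseteq> {0..1}" "B \<subseteq> {0..1}"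
    by (auto simp: sets_restrict_space_iff)
  have "emeasure ?R (A \<times> B) = emeasure lborel (A \<times> B)"
    using AB S by (intro emeasure_restrict_space) auto
  also have "\<dots> = emeasure (lborel \<Otimes>\<^sub>M lborel) (A \<times> B)" by (simp only: lborel_prod)
  also have "\<dots> = emeasure lborel A * emeasure lborel B"
    using AB by (intro lborel.emeasure_pair_measure_Times) auto
  finally show "emeasure unit_interval A * emeasure unit_interval B = emeasure ?R (A \<times> B)"
    using AB by (simp add: emeasure_restrict_space)
qed

lemma AE_unit_square_iff:
  "(AE z in lebesgue_on ({0..1} \<times> {0..1}). Q z) \<longleftrightarrow> (AE z in unit_interval \<Otimes>\<^sub>M unit_interval. Q z)"
proof -
  have S: "({0..1} \<times> {0..1} :: (real \<times> real) set) \<in> sets borel" by (intro borel_closed closed_Times) auto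
  show ?thesis
    unfolding unit_square_measure using S
    by (subst (1 2) AE_restrict_space_iff) (auto simp: AE_completion_iff)
qed

text \<open>A Borel version of \<open>W\<close> satisfies the two conditions only almost everywhere; truncating and
  antisymmetrising it restores them everywhere.\<close>

lemma tournamenton_kernel:
  assumes W: "tournamenton W"
  obtains K where "U.kernel K" "\<And>x y. K x y + K y x = 2" "\<And>x y. \<bar>K x y - 1\<bar> \<le> 1"
    "AE z in unit_interval \<Otimes>\<^sub>M unit_interval. K (fst z) (snd z) = 2 * W (fst z) (snd z)"
proof -
  let ?S = "{0..1} \<times> {0..1} :: (real \<times> real) set"
  have S: "?S \<in> sets borel" by (intro borel_closed closed_Times) auto
  have "(\<lambda>z. indicator ?S z *\<^sub>R (case z of (x, y) \<Rightarrow> W x y)) \<in> borel_measurable lebesgue"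
    using W S by (subst borel_measurable_restrict_space_iff[symmetric]) (auto simp: tournamenton_def)
  from completion_ex_borel_measurable_real[OF this]
  obtain g where g: "g \<in> borel_measurable lborel"
    and ae: "AE z in lborel. indicator ?S z *\<^sub>R (case z of (x, y) \<Rightarrow> W x y) = g z" by blast
  define h where "h x y = min 1 (max 0 (g (x, y)))" for x y :: real
  \<comment> \<open>Where \<open>h\<close> agrees with \<open>W\<close> at both
    \<open>(x, y)\<close> and \<open>(y, x)\<close>, this is
    \<open>1 + W x y - W y x = 2 * W x y\<close>.\<close>
  define K where "K x y = 1 + h x y - h y x" for x y
  have hm: "U.kernel h"
  proof (rule U.kernelI[of _ 1])
    have "(\<lambda>z. min 1 (max 0 (g z))) \<in> borel_measurable (restrict_space lborel ?S)"
      using g by (intro measurable_restrict_space1 borel_measurable_min borel_measurable_max) auto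
    then show "case_prod h \<in> borel_measurable (unit_interval \<Otimes>\<^sub>M unit_interval)"
      unfolding unit_square_measure by (simp add: h_def case_prod_unfold)
  qed (simp add: h_def)
  have kK: "U.kernel K" unfolding K_def
    by (intro U.kernel_diff U.kernel_add U.kernel_const hm U.kernel_transpose[OF hm])
  have hb: "0 \<le> h x y" "h x y \<le> 1" for x y by (auto simp: h_def)
  have "AE z in restrict_space lborel ?S. g z = W (fst z) (snd z)"
    using S ae by (subst AE_restrict_space_iff) (auto elim!: eventually_mono split: split_indicator)
  then have gW: "AE z in unit_interval \<Otimes>\<^sub>M unit_interval. g (fst z, snd z) = W (fst z) (snd z)"
    unfolding unit_square_measure by simp
  then have "AE z in unit_interval \<Otimes>\<^sub>M unit_interval. g (snd z, fst z) = W (snd z) (fst z)"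
    by (rule U.AE_pair_commute)
  with gW AE_space have "AE z in unit_interval \<Otimes>\<^sub>M unit_interval. K (fst z) (snd z) = 2 * W (fst z) (snd z)"
  proof eventually_elim
    case (elim z)
    obtain x y where z: "z = (x, y)" by force
    have xy: "x \<in> {0..1}" "y \<in> {0..1}" using elim z by (auto simp: space_pair_measure)
    have "0 \<le> W x y" "W x y \<le> 1" "W x y + W y x = 1" "0 \<le> W y x" "W y x \<le> 1"
      using W xy unfolding tournamenton_def by blast+
    with elim show ?case by (simp add: z K_def h_def)
  qed
  moreover have "\<bar>K x y - 1\<bar> \<le> 1" for x y using hb[of x y] hb[of y x] unfolding K_def by linarith
  ultimately show ?thesis using that[of K] kK by (simp add: K_def)
qed

lemma cycle_density_kernel:
  assumes K: "U.kernel K" and l: "l \<ge> 2"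
    and ae: "AE z in unit_interval \<Otimes>\<^sub>M unit_interval. K (fst z) (snd z) = 2 * W (fst z) (snd z)"
  shows "cycle_density W l = U.cycle_integral K l"
proof -
  let ?N = "\<Pi>\<^sub>M i\<in>{..<l}. unit_interval"
  have "AE x in ?N. K (x i) (x (Suc i mod l)) = 2 * W (x i) (x (Suc i mod l))" if "i < l" for i
  proof (rule U.AE_PiM_pair[OF _ _ _ _ ae])
    \<comment> \<open>A loop would evaluate \<open>W\<close> on the diagonal, where
      \<open>ae\<close> gives no information; \<open>l \<ge> 2\<close> excludes it.\<close>
    show "i \<noteq> Suc i mod l" using l that by (cases "Suc i = l") auto
  qed (use that l in auto)
  then have "AE x in ?N. \<forall>i\<in>{..<l}. K (x i) (x (Suc i mod l)) = 2 * W (x i) (x (Suc i mod l))"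
    by (intro AE_finite_allI) auto
  then have "AE x in ?N. cycle_prod K l x / 2 ^ l = cycle_prod W l x"
  proof eventually_elim
    case (elim x)
    then have "cycle_prod K l x = (\<Prod>i<l. 2 * W (x i) (x (Suc i mod l)))"
      unfolding cycle_prod_def by (intro prod.cong) auto
    then show ?case by (simp add: cycle_prod_def prod.distrib)
  qed
  then have eq: "AE x in completion ?N. cycle_prod K l x / 2 ^ l = cycle_prod W l x"
    by (rule AE_completion)
  have meas: "(\<lambda>x. cycle_prod K l x / 2 ^ l) \<in> borel_measurable ?N"
    using U.cycle_prod_measurable[OF K, of l "\<lambda>x. x" ?N] by auto
  have meas': "(\<lambda>x. cycle_prod W l x) \<in> borel_measurable (completion ?N)"
    using completion.measurable_AE_cong[OF measurable_completion[OF meas] eq] by simp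
  have "(LINT x|completion ?N. cycle_prod W l x) = (LINT x|completion ?N. cycle_prod K l x / 2 ^ l)"
    using eq by (intro integral_cong_AE meas' measurable_completion meas) auto
  also have "\<dots> = (LINT x|?N. cycle_prod K l x / 2 ^ l)" by (rule integral_completion[OF meas])
  finally show ?thesis
    by (simp add: cycle_density_def cube_measure_def U.cycle_integral_def cycle_prod_def)
qed

lemma cycle_density_tournamenton:
  assumes W: "tournamenton W" and l: "l \<ge> 6" "l mod 4 = 2"
  shows "cycle_density W l \<le> 1"
    and "cycle_density W l = 1 \<longleftrightarrow> (AE (x, y) in lebesgue_on ({0..1} \<times> {0..1}). W x y = 1 / 2)"
proof -
  obtain K where K: "U.kernel K" and sym: "\<And>x y. K x y + K y x = 2" and bd: "\<And>x y. \<bar>K x y - 1\<bar> \<le> 1"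
    and ae: "AE z in unit_interval \<Otimes>\<^sub>M unit_interval. K (fst z) (snd z) = 2 * W (fst z) (snd z)"
    using tournamenton_kernel[OF W] by blast
  have cd: "cycle_density W l = U.cycle_integral K l" using l by (intro cycle_density_kernel[OF K _ ae]) auto
  have "\<bar>K x y - 1\<bar> \<le> 101 / 100" for x y using bd[of x y] by linarith
  then show "cycle_density W l \<le> 1" unfolding cd using l sym by (intro U.cycle_integral_le_1[OF K])
  have AE: "(AE (x, y) in lebesgue_on ({0..1} \<times> {0..1}). W x y = 1 / 2) \<longleftrightarrow>
      (AE z in unit_interval \<Otimes>\<^sub>M unit_interval. W (fst z) (snd z) = 1 / 2)"
    by (simp only: AE_unit_square_iff case_prod_unfold)
  show "cycle_density W l = 1 \<longleftrightarrow> (AE (x, y) in lebesgue_on ({0..1} \<times> {0..1}). W x y = 1 / 2)"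
    unfolding AE
  proof
    assume "cycle_density W l = 1"
    then have "AE z in unit_interval \<Otimes>\<^sub>M unit_interval. K (fst z) (snd z) = 1"
      using l sym bd unfolding cd by (intro U.cycle_integral_eq_1_imp[OF K])
    with ae show "AE z in unit_interval \<Otimes>\<^sub>M unit_interval. W (fst z) (snd z) = 1 / 2"
      by eventually_elim simp
  next
    assume "AE z in unit_interval \<Otimes>\<^sub>M unit_interval. W (fst z) (snd z) = 1 / 2"
    then have "AE z in unit_interval \<Otimes>\<^sub>M unit_interval. 1 = 2 * W (fst z) (snd z)"
      by eventually_elim simp
    then have "cycle_density W l = U.cycle_integral (\<lambda>x y. 1) l"
      using l by (intro cycle_density_kernel U.kernel_const) auto
    also have "\<dots> = 1"
    proof -
      interpret N: prob_space "\<Pi>\<^sub>M i\<in>{..<l}. unit_interval" by (intro prob_space_PiM U.prob_space_axioms)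
      show ?thesis by (simp add: U.cycle_integral_def cycle_prod_def N.prob_space)
    qed
    finally show "cycle_density W l = 1" .
  qed
qed

section \<open>Cycles in tournaments\<close>

definition cycle_arcs :: "'a list \<Rightarrow> ('a \<times> 'a) set" where
  "cycle_arcs vs = {(vs ! i, vs ! (Suc i mod length vs)) | i. i < length vs}"

definition cycle_words :: "(nat \<times> nat) set \<Rightarrow> nat \<Rightarrow> nat \<Rightarrow> nat list set" where
  "cycle_words E n l = {vs \<in> distinct_words n l. cycle_arcs vs \<subseteq> E}"

lemma finite_cycle_words [simp]: "finite (cycle_words E n l)"
  by (simp add: cycle_words_def)

lemma dicycles_eq_image:
  assumes "E \<subseteq> {..<n} \<times> {..<n}"
  shows "dicycles E l = cycle_arcs ` cycle_words E n l"
proof -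
  have words: "vs \<in> words n l" if "length vs = l" "cycle_arcs vs \<subseteq> E" for vs
  proof -
    have "vs ! i < n" if "i < l" for i
    proof -
      have "(vs ! i, vs ! (Suc i mod length vs)) \<in> cycle_arcs vs"
        using that \<open>length vs = l\<close> unfolding cycle_arcs_def by blast
      then show ?thesis using \<open>cycle_arcs vs \<subseteq> E\<close> assms by auto
    qed
    then show ?thesis using that by (auto simp: words_def in_set_conv_nth)
  qed
  have "C \<in> dicycles E l \<longleftrightarrow> (\<exists>vs. length vs = l \<and> distinct vs \<and> cycle_arcs vs \<subseteq> E \<and> C = cycle_arcs vs)" for C
    unfolding dicycles_def cycle_arcs_def by (rule iffI; elim exE conjE CollectE; hypsubst?; blast)
  moreover have "vs \<in> cycle_words E n l \<longleftrightarrow> length vs = l \<and> distinct vs \<and> cycle_arcs vs \<subseteq> E" for vs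
    using words[of vs] by (auto simp: cycle_words_def distinct_words_def words_def)
  ultimately show ?thesis by auto
qed

lemma cycle_arcs_rotate:
  shows "cycle_arcs (rotate j vs) = cycle_arcs vs"
proof (cases "vs = []")
  case False
  define l where "l = length vs"
  have l: "l > 0" using False by (simp add: l_def)
  have nth: "rotate j vs ! i = vs ! ((i + j) mod l)" if "i < l" for i
    using that by (simp add: nth_rotate l_def add.commute)
  have arc: "(rotate j vs ! i, rotate j vs ! (Suc i mod l)) = (vs ! ((i + j) mod l), vs ! (Suc ((i + j) mod l) mod l))"
    if "i < l" for i
    using that l nth[of i] nth[of "Suc i mod l"] by (simp add: mod_simps)
  have im: "(\<lambda>i. (i + j) mod l) ` {..<l} = {..<l}"
  proof (intro subset_antisym subsetI)
    fix k assume "k \<in> {..<l}"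
    then have k: "k < l" by simp
    \<comment> \<open>The inverse shift; reducing \<open>j\<close> first keeps the subtraction of
      natural numbers exact.\<close>
    let ?i = "(k + (l - j mod l)) mod l"
    have "(?i + j) mod l = (k + (l - j mod l) + j mod l) mod l" by (simp add: mod_simps)
    also have "k + (l - j mod l) + j mod l = k + l"
      using mod_less_divisor[OF l, of j] by linarith
    finally have "k = (?i + j) mod l" using k by simp
    then show "k \<in> (\<lambda>i. (i + j) mod l) ` {..<l}" using l by (intro image_eqI[of _ _ ?i]) auto
  qed (use l in auto)
  have "cycle_arcs (rotate j vs) = (\<lambda>k. (vs ! k, vs ! (Suc k mod l))) ` (\<lambda>i. (i + j) mod l) ` {..<l}"
    unfolding cycle_arcs_def using arc by (auto simp: l_def image_iff) (metis)+
  also have "\<dots> = cycle_arcs vs" unfolding im cycle_arcs_def by (auto simp: l_def)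
  finally show ?thesis .
qed simp

text \<open>In a cycle with distinct vertices the arc set determines the successor of each vertex,
  so \<open>ws\<close> follows \<open>vs\<close> from the position \<open>j\<close> of its first
  vertex.\<close>

lemma same_cycle_arcs_rotate:
  assumes vs: "distinct vs" "length vs = l" and ws: "length ws = l" and l: "l > 0"
    and eq: "cycle_arcs ws = cycle_arcs vs"
  shows "\<exists>j<l. ws = rotate j vs"
proof -
  have arc: "\<exists>k<l. ws ! i = vs ! k \<and> ws ! (Suc i mod l) = vs ! (Suc k mod l)" if "i < l" for i
  proof -
    have "(ws ! i, ws ! (Suc i mod l)) \<in> cycle_arcs ws" using that ws unfolding cycle_arcs_def by blast
    then show ?thesis unfolding eq using vs by (auto simp: cycle_arcs_def)
  qed
  obtain j where j: "j < l" "ws ! 0 = vs ! j" using arc[of 0] l by blast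
  have "ws ! i = vs ! ((i + j) mod l)" if "i < l" for i
    using that
  proof (induction i)
    case 0 then show ?case using j by simp
  next
    case (Suc i)
    obtain k where k: "k < l" "ws ! i = vs ! k" "ws ! (Suc i mod l) = vs ! (Suc k mod l)"
      using arc[of i] Suc.prems by auto
    have "vs ! k = vs ! ((i + j) mod l)" using k Suc by simp
    then have "k = (i + j) mod l" using vs k(1) l by (simp add: nth_eq_iff_index_eq)
    then show ?case using k Suc.prems by (simp add: mod_simps)
  qed
  then have "ws = rotate j vs"
    using vs ws by (intro nth_equalityI) (auto simp: nth_rotate add.commute)
  then show ?thesis using j by blast
qed

text \<open>The fibres of \<open>cycle_arcs\<close> are the sets of rotations, and the
  \<open>l\<close> rotations of a distinct word are different.\<close>

lemma card_cycle_words: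
  assumes E: "E \<subseteq> {..<n} \<times> {..<n}" and l: "l > 0"
  shows "card (cycle_words E n l) = l * card (dicycles E l)"
proof -
  have fibre: "card {ws \<in> cycle_words E n l. cycle_arcs ws = cycle_arcs vs} = l" if vs: "vs \<in> cycle_words E n l" for vs
  proof -
    have d: "distinct vs" "length vs = l" using vs by (auto simp: cycle_words_def distinct_words_def words_def)
    have "{ws \<in> cycle_words E n l. cycle_arcs ws = cycle_arcs vs} = (\<lambda>j. rotate j vs) ` {..<l}"
    proof (intro subset_antisym subsetI)
      fix ws assume ws: "ws \<in> {ws \<in> cycle_words E n l. cycle_arcs ws = cycle_arcs vs}"
      then have "length ws = l" by (auto simp: cycle_words_def distinct_words_def words_def)
      from same_cycle_arcs_rotate[OF d this l] ws show "ws \<in> (\<lambda>j. rotate j vs) ` {..<l}" by auto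
    next
      fix ws assume "ws \<in> (\<lambda>j. rotate j vs) ` {..<l}"
      then show "ws \<in> {ws \<in> cycle_words E n l. cycle_arcs ws = cycle_arcs vs}"
        using vs by (auto simp: cycle_words_def distinct_words_def words_def cycle_arcs_rotate)
    qed
    moreover have "inj_on (\<lambda>j. rotate j vs) {..<l}"
    proof (rule inj_onI)
      fix i j assume ij: "i \<in> {..<l}" "j \<in> {..<l}" and "rotate i vs = rotate j vs"
      then have "rotate i vs ! 0 = rotate j vs ! 0" by simp
      then show "i = j" using ij d l by (simp add: nth_rotate nth_eq_iff_index_eq)
    qed
    ultimately show ?thesis by (simp add: card_image)
  qed
  have "card (cycle_words E n l) = (\<Sum>vs\<in>cycle_words E n l. 1)" by simp
  also have "\<dots> = (\<Sum>C\<in>cycle_arcs ` cycle_words E n l. card {ws \<in> cycle_words E n l. cycle_arcs ws = C})"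
    by (subst sum.image_gen[of _ _ cycle_arcs]) simp_all
  also have "\<dots> = (\<Sum>C\<in>cycle_arcs ` cycle_words E n l. l)"
    by (intro sum.cong refl) (use fibre in auto)
  also have "\<dots> = l * card (dicycles E l)" by (simp add: dicycles_eq_image[OF E])
  finally show ?thesis .
qed

text \<open>Apply the matrix bound to twice the adjacency matrix, with diagonal 1 as
  \<open>sym\<close> demands. A directed cycle contributes \<open>2 ^ l\<close>; all other words
  contribute nonnegative amounts and can be added.\<close>

lemma cycle_words_upper:
  assumes T: "tournament {..<n} E" and l: "l \<ge> 6" "l mod 4 = 2"
  shows "2 ^ l * real (card (cycle_words E n l)) \<le> real n ^ l"
proof -
  define a :: "nat \<Rightarrow> nat \<Rightarrow> real" where "a i j = (if i = j then 1 else if (i, j) \<in> E then 2 else 0)" for i j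
  have sub: "cycle_words E n l \<subseteq> words n l" by (auto simp: cycle_words_def distinct_words_def)
  have two: "cycle_prod a l ((!) vs) = 2 ^ l" if vs: "vs \<in> cycle_words E n l" for vs
  proof -
    have "a (vs ! i) (vs ! (Suc i mod l)) = 2" if "i < l" for i
    proof -
      have "(vs ! i, vs ! (Suc i mod l)) \<in> E"
        using vs that by (auto simp: cycle_words_def distinct_words_def words_def cycle_arcs_def)
      moreover have "irrefl E" using T by (simp add: tournament_def)
      ultimately show ?thesis by (auto simp: a_def irrefl_def)
    qed
    then show ?thesis by (simp add: cycle_prod_def)
  qed
  have "2 ^ l * real (card (cycle_words E n l)) = (\<Sum>vs\<in>cycle_words E n l. cycle_prod a l ((!) vs))"
    using two by simp
  also have "\<dots> \<le> (\<Sum>vs\<in>words n l. cycle_prod a l ((!) vs))"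
    using sub by (intro sum_mono2) (auto simp: cycle_prod_def a_def intro!: prod_nonneg)
  also have "\<dots> \<le> real n ^ l"
  proof (rule sum_words_cycle_prod_le[OF _ _ l])
    show "a i j + a j i = 2" if "i < n" "j < n" for i j
    proof (cases "i = j")
      case False
      then have "(i, j) \<in> E \<longleftrightarrow> (j, i) \<notin> E" using T that unfolding tournament_def by blast
      then show ?thesis using False by (auto simp: a_def)
    qed (simp add: a_def)
    show "\<bar>a i j - 1\<bar> \<le> 101 / 100" for i j by (simp add: a_def)
  qed
  finally show ?thesis .
qed

section \<open>Averaging over all tournaments\<close>

lemma tournamentD:
  assumes "tournament V E"
  shows "E \<subseteq> V \<times> V" "(x, x) \<notin> E"
    "x \<in> V \<Longrightarrow> y \<in> V \<Longrightarrow> x \<noteq> y \<Longrightarrow> (x, y) \<in> E \<longleftrightarrow> (y, x) \<notin> E"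
  using assms unfolding tournament_def irrefl_def by blast+

lemma finite_tournaments: "finite {E. tournament {..<n::nat} E}"
  by (rule finite_subset[of _ "Pow ({..<n} \<times> {..<n})"]) (auto dest: tournamentD(1))

lemma tournament_exists: "tournament {..<n::nat} {(i, j). i < j \<and> j < n}"
  by (auto simp: tournament_def irrefl_def)

lemma tournament_flip:
  assumes T: "tournament V E" and uv: "(u, v) \<in> E"
  shows "tournament V (insert (v, u) (E - {(u, v)}))"
proof -
  note E = tournamentD(1)[OF T] and irr = tournamentD(2)[OF T] and asym = tournamentD(3)[OF T]
  have "u \<noteq> v" "u \<in> V" "v \<in> V" using uv irr[of u] E by auto
  have "(x, y) \<in> insert (v, u) (E - {(u, v)}) \<longleftrightarrow> (y, x) \<notin> insert (v, u) (E - {(u, v)})"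
    if "x \<in> V" "y \<in> V" "x \<noteq> y" for x y
    using asym[OF that] uv \<open>u \<noteq> v\<close> by auto
  moreover have "insert (v, u) (E - {(u, v)}) \<subseteq> V \<times> V" using E \<open>u \<in> V\<close> \<open>v \<in> V\<close> by blast
  moreover have "irrefl (insert (v, u) (E - {(u, v)}))" using irr \<open>u \<noteq> v\<close> by (auto simp: irrefl_def)
  ultimately show ?thesis unfolding tournament_def by blast
qed

text \<open>Reversing one arc is a bijection between the tournaments with that arc and those with
  its reverse, so each prescribed arc halves the count.\<close>

lemma card_tournaments_containing:
  assumes "finite V" "finite X" "X \<subseteq> V \<times> V" and "\<And>u v. (u, v) \<in> X \<Longrightarrow> (v, u) \<notin> X"
  shows "2 ^ card X * card {E. tournament V E \<and> X \<subseteq> E} = card {E. tournament V E}"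
  using assms(2,3,4)
proof (induction X rule: finite_induct)
  case (insert p X)
  obtain u v where p: "p = (u, v)" by force
  let ?T = "\<lambda>X. {E. tournament V E \<and> X \<subseteq> E}"
  have fin: "finite (?T Y)" for Y
    by (rule finite_subset[of _ "Pow (V \<times> V)"]) (use \<open>finite V\<close> in \<open>auto dest: tournamentD(1)\<close>)
  have uv: "u \<in> V" "v \<in> V" "(v, u) \<notin> X" "(u, v) \<notin> X" "u \<noteq> v"
    using insert.hyps(2) insert.prems(1) insert.prems(2)[of u v] unfolding p by auto
  have uvE: "(u, v) \<in> E \<longleftrightarrow> (v, u) \<notin> E" if "tournament V E" for E
    using tournamentD(3)[OF that uv(1,2,5)] .
  have disj: "?T (insert (u, v) X) \<inter> ?T (insert (v, u) X) = {}"
    using uvE by blast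
  have "?T X = ?T (insert (u, v) X) \<union> ?T (insert (v, u) X)"
    using uvE by blast
  then have "card (?T X) = card (?T (insert (u, v) X)) + card (?T (insert (v, u) X))"
    using disj fin by (simp only: card_Un_disjoint)
  also have "card (?T (insert (v, u) X)) = card (?T (insert (u, v) X))"
  proof (rule bij_betw_same_card[OF bij_betw_byWitness[of _ "\<lambda>E. insert (v, u) (E - {(u, v)})" "\<lambda>E. insert (u, v) (E - {(v, u)})"]])
    show "(\<lambda>E. insert (u, v) (E - {(v, u)})) ` ?T (insert (v, u) X) \<subseteq> ?T (insert (u, v) X)"
      using uv tournament_flip[of V _ v u] by blast
    show "(\<lambda>E. insert (v, u) (E - {(u, v)})) ` ?T (insert (u, v) X) \<subseteq> ?T (insert (v, u) X)"
      using uv tournament_flip[of V _ u v] by blast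
    show "\<forall>E\<in>?T (insert (v, u) X). insert (v, u) (insert (u, v) (E - {(v, u)}) - {(u, v)}) = E"
      using uv uvE by blast
    show "\<forall>E\<in>?T (insert (u, v) X). insert (u, v) (insert (v, u) (E - {(u, v)}) - {(v, u)}) = E"
      using uv uvE by blast
  qed
  finally have "card (?T X) = 2 * card (?T (insert p X))" by (simp add: p)
  moreover have "2 ^ card X * card (?T X) = card {E. tournament V E}"
  proof (rule insert.IH)
    show "X \<subseteq> V \<times> V" using insert.prems(1) by blast
    show "(y, x) \<notin> X" if "(x, y) \<in> X" for x y using insert.prems(2)[of x y] that by blast
  qed
  ultimately show ?case using insert.hyps by (simp add: mult_ac)
qed simp

text \<open>The hypothesis on \<open>X\<close> in \<open>card_tournaments_containing\<close>. It
  needs \<open>l \<ge> 3\<close>: a cycle of length 2 consists of opposite arcs.\<close>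

lemma cycle_arcs_oriented:
  assumes vs: "distinct vs" "length vs = l" and l: "l \<ge> 3"
  shows "card (cycle_arcs vs) = l" "finite (cycle_arcs vs)" "\<And>u v. (u, v) \<in> cycle_arcs vs \<Longrightarrow> (v, u) \<notin> cycle_arcs vs"
proof -
  have im: "cycle_arcs vs = (\<lambda>i. (vs ! i, vs ! (Suc i mod l))) ` {..<l}"
    using vs by (auto simp: cycle_arcs_def)
  show "finite (cycle_arcs vs)" by (simp add: im)
  have "inj_on (\<lambda>i. (vs ! i, vs ! (Suc i mod l))) {..<l}"
    using vs by (auto simp: inj_on_def nth_eq_iff_index_eq)
  then show "card (cycle_arcs vs) = l" by (simp add: im card_image)
  fix u v assume uv: "(u, v) \<in> cycle_arcs vs"
  show "(v, u) \<notin> cycle_arcs vs"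
  proof
    assume "(v, u) \<in> cycle_arcs vs"
    then obtain i j where ij: "i < l" "j < l" "vs ! i = vs ! (Suc j mod l)" "vs ! j = vs ! (Suc i mod l)"
      using uv by (auto simp: im)
    moreover have "Suc k mod l < l" for k using l by simp
    ultimately have "i = Suc j mod l" "j = Suc i mod l" using vs by (simp_all add: nth_eq_iff_index_eq)
    moreover have wrap: "Suc k = l \<and> Suc k mod l = 0 \<or> Suc k < l \<and> Suc k mod l = Suc k" if "k < l" for k
      using that by (cases "Suc k = l") auto
    ultimately show False using wrap[OF ij(1)] wrap[OF ij(2)] l by linarith
  qed
qed

text \<open>Double counting: every distinct word is a directed cycle in a fraction
  \<open>1 / 2 ^ l\<close> of all tournaments, so some tournament reaches the average.\<close>

lemma cycle_words_lower:
  assumes l: "l \<ge> 3"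
  shows "\<exists>E. tournament {..<n} E \<and> card (distinct_words n l) \<le> 2 ^ l * card (cycle_words E n l)"
proof (rule ccontr)
  assume "\<not> ?thesis"
  then have less: "2 ^ l * card (cycle_words E n l) < card (distinct_words n l)" if "tournament {..<n} E" for E
    using that by (meson not_le)
  let ?T = "{E. tournament {..<n} E}"
  have "(\<Sum>E\<in>?T. 2 ^ l * card (cycle_words E n l)) = 2 ^ l * (\<Sum>E\<in>?T. \<Sum>vs\<in>{vs\<in>distinct_words n l. cycle_arcs vs \<subseteq> E}. 1)"
    by (simp add: cycle_words_def sum_distrib_left)
  also have "(\<Sum>E\<in>?T. \<Sum>vs\<in>{vs\<in>distinct_words n l. cycle_arcs vs \<subseteq> E}. 1::nat)
    = (\<Sum>vs\<in>distinct_words n l. \<Sum>E\<in>{E\<in>?T. cycle_arcs vs \<subseteq> E}. 1)"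
    by (rule sum.swap_restrict) (auto intro: finite_tournaments)
  also have "2 ^ l * \<dots> = (\<Sum>vs\<in>distinct_words n l. 2 ^ l * card {E. tournament {..<n} E \<and> cycle_arcs vs \<subseteq> E})"
    by (simp add: sum_distrib_left)
  also have "\<dots> = (\<Sum>vs\<in>distinct_words n l. card ?T)"
  proof (rule sum.cong[OF refl])
    fix vs assume vs: "vs \<in> distinct_words n l"
    then have d: "distinct vs" "length vs = l"
      by (auto simp: distinct_words_def words_def)
    have "cycle_arcs vs \<subseteq> {..<n} \<times> {..<n}"
    proof -
      have "vs \<in> words n l" using vs by (simp add: distinct_words_def)
      moreover have "Suc i mod l < l" for i using l by simp
      ultimately show ?thesis using d(2) nth_words[of vs n l] by (auto simp: cycle_arcs_def)
    qed
    from card_tournaments_containing[OF _ _ this] cycle_arcs_oriented[OF d l]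
    show "2 ^ l * card {E. tournament {..<n} E \<and> cycle_arcs vs \<subseteq> E} = card ?T" by simp
  qed
  also have "\<dots> = (\<Sum>E\<in>?T. card (distinct_words n l))" by simp
  finally have "(\<Sum>E\<in>?T. 2 ^ l * card (cycle_words E n l)) = (\<Sum>E\<in>?T. card (distinct_words n l))" .
  moreover have "(\<Sum>E\<in>?T. 2 ^ l * card (cycle_words E n l)) < (\<Sum>E\<in>?T. card (distinct_words n l))"
    using less tournament_exists[of n] by (intro sum_strict_mono finite_tournaments) auto
  ultimately show False by simp
qed

section \<open>The limit of the cycle ratio\<close>

lemma max_cycles_bounds:
  assumes l: "l \<ge> 6" "l mod 4 = 2"
  shows "real (card (distinct_words n l)) \<le> 2 ^ l * (real l * real (max_cycles n l))"
    and "2 ^ l * (real l * real (max_cycles n l)) \<le> real n ^ l"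
proof -
  let ?C = "{card (dicycles E l) | E. tournament {..<n} E}"
  have img: "?C = (\<lambda>E. card (dicycles E l)) ` {E. tournament {..<n} E}" by auto
  have fin: "finite ?C" unfolding img by (intro finite_imageI finite_tournaments)
  have ne: "?C \<noteq> {}" using tournament_exists[of n] by auto
  have card: "real (card (cycle_words E n l)) = real l * real (card (dicycles E l))" if "tournament {..<n} E" for E
    using card_cycle_words[of E n l] that l by (simp add: tournament_def)
  obtain E where E: "tournament {..<n} E" "card (distinct_words n l) \<le> 2 ^ l * card (cycle_words E n l)"
    using cycle_words_lower[of l n] l by auto
  have "real (card (distinct_words n l)) \<le> real (2 ^ l * card (cycle_words E n l))"
    using E(2) by (simp only: of_nat_le_iff)
  also have "\<dots> = 2 ^ l * (real l * real (card (dicycles E l)))" by (simp add: card[OF E(1)])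
  also have "\<dots> \<le> 2 ^ l * (real l * real (max_cycles n l))"
    unfolding max_cycles_def using fin E by (intro mult_left_mono) (auto intro!: Max_ge)
  finally show "real (card (distinct_words n l)) \<le> 2 ^ l * (real l * real (max_cycles n l))" .
  have "max_cycles n l \<in> ?C" unfolding max_cycles_def using fin ne by (rule Max_in)
  then obtain E' where E': "tournament {..<n} E'" "max_cycles n l = card (dicycles E' l)" by blast
  show "2 ^ l * (real l * real (max_cycles n l)) \<le> real n ^ l"
    using cycle_words_upper[OF E'(1) l] by (simp add: E'(2) card[OF E'(1)])
qed

text \<open>Counting cycles as words costs a factor \<open>l\<close>, which turns
  \<open>fact (l - 1)\<close> into \<open>fact l\<close> and the denominator into the number of
  distinct words. The ratio is then squeezed between 1 and \<open>1 / d n\<close>.\<close>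

lemma cycle_ratio_limit:
  assumes l: "l \<ge> 6" "l mod 4 = 2"
  shows "cycle_ratio l \<longlonglongrightarrow> 1"
proof -
  define d where "d n = real (card (distinct_words n l)) / real n ^ l" for n
  have "d \<longlonglongrightarrow> 1" unfolding d_def by (rule card_distinct_words_limit)
  then have lim: "(\<lambda>n. 1 / d n) \<longlonglongrightarrow> 1" using tendsto_divide[OF tendsto_const, of d 1 sequentially 1] by simp
  have ratio: "cycle_ratio l n = 2 ^ l * (real l * real (max_cycles n l)) / real (card (distinct_words n l))" if "n \<ge> l" for n
  proof -
    have "fact l = real l * fact (l - 1)" using l by (intro fact_reduce) auto
    then show ?thesis using that l
      by (simp add: cycle_ratio_def random_cycles_def card_distinct_words_fact field_simps)
  qed
  have pos: "real (card (distinct_words n l)) > 0" if "n \<ge> l" for n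
    using that by (simp add: card_distinct_words_fact)
  have low: "\<forall>\<^sub>F n in sequentially. 1 \<le> cycle_ratio l n"
    using eventually_ge_at_top[of l]
    by eventually_elim (use max_cycles_bounds(1)[OF l] ratio pos in \<open>simp add: le_divide_eq\<close>)
  have up: "\<forall>\<^sub>F n in sequentially. cycle_ratio l n \<le> 1 / d n"
    using eventually_ge_at_top[of l]
    by eventually_elim (use max_cycles_bounds(2)[OF l] ratio pos in \<open>simp add: d_def divide_right_mono\<close>)
  show ?thesis by (rule tendsto_sandwich[OF low up tendsto_const lim])
qed

theorem theorem12:
  fixes l :: nat
  assumes "l \<ge> 6" and "even l" and "\<not> 4 dvd l"
  shows "(\<forall>W. tournamenton W \<longrightarrow>
            cycle_density W l \<le> 1 \<and>
            (cycle_density W l = 1 \<longleftrightarrow>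
               (AE (x, y) in lebesgue_on ({0..1} \<times> {0..1}). W x y = 1 / 2))) \<and>
         convergent (cycle_ratio l) \<and> cycle_limit l = 1"
proof (intro conjI allI impI)
  have l: "l mod 4 = 2" using assms by presburger
  show "cycle_density W l \<le> 1" if "tournamenton W" for W
    by (rule cycle_density_tournamenton(1)[OF that assms(1) l])
  show "cycle_density W l = 1 \<longleftrightarrow> (AE (x, y) in lebesgue_on ({0..1} \<times> {0..1}). W x y = 1 / 2)"
    if "tournamenton W" for W
    by (rule cycle_density_tournamenton(2)[OF that assms(1) l])
  have lim: "cycle_ratio l \<longlonglongrightarrow> 1" by (rule cycle_ratio_limit[OF assms(1) l])
  then show "convergent (cycle_ratio l)" by (rule convergentI)
  show "cycle_limit l = 1" unfolding cycle_limit_def using lim by (rule limI)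
qed

end
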